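(* Let $N\ge 2$, $R\in(0,\infty)$, $\delta\in[0,R)$ and $\alpha>R$. Let $f:[\delta,R]\times[0,\alpha)\to[0,\infty)$ be continuous with $f(r,s)>0$ for all $(r,s)\in[\delta,R]\times(0,\alpha)$. Suppose that $\lim_{s\to0^+}\frac{f(r,s)}{s}=\infty$ uniformly in $r\in[\delta,R]$, and $f(r,0)=0$ for $r\in[\delta,R]$. Then there exists a connected component $\zeta$ of $\Sigma_\delta$ (the closure of the set of nontrivial solutions, defined in the context) such that: (a) $\zeta\setminus\{(0,\theta)\}\subset(0,\infty)\times\operatorname{int}P_\delta$; (b) $\zeta$ joins $(0,\theta)$ with infinity in the $\lambda$ direction; (c) $\operatorname{Proj}_{\mathbb R}\zeta=[0,\infty)$; (d) for every $n\in\mathbb N$, $\displaystyle\lim_{(\lambda,u)\in\zeta,\ \lambda\to\infty}\operatorname{meas}\Big\{r\in[\delta,R]:|u'(r)-(-1)|>\tfrac1n\Big\}=0$; (e) $\displaystyle\lim_{(\lambda,u)\in\zeta,\ \lambda\to\infty}\|u\|_{C[\delta,R]}=R-\delta$.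
   Context: Let $\phi_1(s)=\frac{s}{\sqrt{1-s^2}}$ for $|s|<1$. For $\lambda\ge0$ consider the boundary value problem $$(r^{N-1}\phi_1(u'))'+\lambda r^{N-1}f(r,u)=0\ \text{ on }(\delta,R),\qquad u'(\delta)=u(R)=0. \tag{P}$$ A solution of (P) is a function $u\in C^1[\delta,R]$ with values in $[0,\alpha)$ (where $f$ is defined), with $|u'|<1$ on $[\delta,R]$, with $r^{N-1}\phi_1(u')$ continuously differentiable, satisfying (P). $E_\delta=\{u\in C^1[\delta,R]:u'(\delta)=u(R)=0\}$ with norm $\|u\|_{C^1[\delta,R]}=\sup|u|+\sup|u'|$; $\|u\|_{C[\delta,R]}=\sup_{[\delta,R]}|u|$; $\theta$ is the zero element of $E_\delta$. $P_\delta=\{u\in E_\delta:u(t)\ge0,\ t\in[\delta,R]\}$, and $\operatorname{int}P_\delta$ is its interior in $E_\delta$. $\Sigma_\delta$ is the closure in $\mathbb R\times E_\delta$ of $\{(\lambda,u)\in[0,\infty)\times C^1[\delta,R]: u\text{ satisfies (P)},\ u\not\equiv0\}$. A component of a set is a maximal connected subset. $\operatorname{Proj}_{\mathbb R}\zeta$ is the set of $\lambda$ such that $(\lambda,u)\in\zeta$ for some $u$. "$\zeta$ joins $(\lambda_0,\theta)$ with infinity in the $\lambda$ direction" means that $(\lambda_0,\theta)\in\zeta$ and $\zeta$ contains pairs $(\lambda,u)$ with $\lambda$ arbitrarily large. $\operatorname{meas}$ is Lebesgue measure. *)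

theory Defs
  imports "HOL-Analysis.Analysis"
begin

definition phi1 :: "real \<Rightarrow> real" where
  "phi1 s = s / sqrt (1 - s\<^sup>2)"

text \<open>The derivative relative to the closed interval, so one-sided at the endpoints.\<close>

definition der :: "real \<Rightarrow> real \<Rightarrow> (real \<Rightarrow> real) \<Rightarrow> real \<Rightarrow> real" where
  "der \<delta> R u r = vector_derivative u (at r within {\<delta>..R})"

definition C1_on :: "real \<Rightarrow> real \<Rightarrow> (real \<Rightarrow> real) \<Rightarrow> bool" where
  "C1_on \<delta> R u \<longleftrightarrow> u differentiable_on {\<delta>..R} \<and> continuous_on {\<delta>..R} (der \<delta> R u)"

definition sup_norm :: "real \<Rightarrow> real \<Rightarrow> (real \<Rightarrow> real) \<Rightarrow> real" where
  "sup_norm \<delta> R u = (SUP r\<in>{\<delta>..R}. \<bar>u r\<bar>)"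

definition C1_norm :: "real \<Rightarrow> real \<Rightarrow> (real \<Rightarrow> real) \<Rightarrow> real" where
  "C1_norm \<delta> R u = sup_norm \<delta> R u + sup_norm \<delta> R (der \<delta> R u)"

text \<open>A function on \<open>[\<delta>, R]\<close> is represented by the total function that takes the value
  \<^term>\<open>undefined\<close> outside the interval; this makes the representative unique.\<close>

definition E_space :: "real \<Rightarrow> real \<Rightarrow> (real \<Rightarrow> real) set" where
  "E_space \<delta> R = {u \<in> extensional {\<delta>..R}. C1_on \<delta> R u \<and> der \<delta> R u \<delta> = 0 \<and> u R = 0}"

text \<open>The locale \<^locale>\<open>Metric_space\<close> asks for nonnegativity and symmetry of the distance on the
  whole type, hence the default value \<open>0\<close> off the carrier.\<close>

definition E_dist :: "real \<Rightarrow> real \<Rightarrow> (real \<Rightarrow> real) \<Rightarrow> (real \<Rightarrow> real) \<Rightarrow> real" where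
  "E_dist \<delta> R u v =
     (if u \<in> E_space \<delta> R \<and> v \<in> E_space \<delta> R then C1_norm \<delta> R (\<lambda>r. u r - v r) else 0)"

definition E_top :: "real \<Rightarrow> real \<Rightarrow> (real \<Rightarrow> real) topology" where
  "E_top \<delta> R = Metric_space.mtopology (E_space \<delta> R) (E_dist \<delta> R)"

definition E_zero :: "real \<Rightarrow> real \<Rightarrow> real \<Rightarrow> real" where
  "E_zero \<delta> R = restrict (\<lambda>r. 0) {\<delta>..R}"

definition P_cone :: "real \<Rightarrow> real \<Rightarrow> (real \<Rightarrow> real) set" where
  "P_cone \<delta> R = {u \<in> E_space \<delta> R. \<forall>t\<in>{\<delta>..R}. 0 \<le> u t}"

definition int_P :: "real \<Rightarrow> real \<Rightarrow> (real \<Rightarrow> real) set" where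
  "int_P \<delta> R = E_top \<delta> R interior_of P_cone \<delta> R"

definition is_solution ::
  "nat \<Rightarrow> real \<Rightarrow> real \<Rightarrow> real \<Rightarrow> (real \<Rightarrow> real \<Rightarrow> real) \<Rightarrow> real \<Rightarrow> (real \<Rightarrow> real) \<Rightarrow> bool" where
  "is_solution N \<delta> R \<alpha> f l u \<longleftrightarrow>
     C1_on \<delta> R u \<and>
     (\<forall>r\<in>{\<delta>..R}. 0 \<le> u r \<and> u r < \<alpha>) \<and>
     (\<forall>r\<in>{\<delta>..R}. \<bar>der \<delta> R u r\<bar> < 1) \<and>
     C1_on \<delta> R (\<lambda>r. r ^ (N - 1) * phi1 (der \<delta> R u r)) \<and>
     (\<forall>r\<in>{\<delta><..<R}.
        der \<delta> R (\<lambda>t. t ^ (N - 1) * phi1 (der \<delta> R u t)) r + l * r ^ (N - 1) * f r (u r) = 0) \<and>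
     der \<delta> R u \<delta> = 0 \<and> u R = 0"

definition nontrivial_solutions ::
  "nat \<Rightarrow> real \<Rightarrow> real \<Rightarrow> real \<Rightarrow> (real \<Rightarrow> real \<Rightarrow> real) \<Rightarrow> (real \<times> (real \<Rightarrow> real)) set" where
  "nontrivial_solutions N \<delta> R \<alpha> f =
     {(l, u). 0 \<le> l \<and> u \<in> extensional {\<delta>..R} \<and> is_solution N \<delta> R \<alpha> f l u \<and>
        (\<exists>r\<in>{\<delta>..R}. u r \<noteq> 0)}"

definition RE_top :: "real \<Rightarrow> real \<Rightarrow> (real \<times> (real \<Rightarrow> real)) topology" where
  "RE_top \<delta> R = prod_topology euclideanreal (E_top \<delta> R)"

definition Sigma_set ::
  "nat \<Rightarrow> real \<Rightarrow> real \<Rightarrow> real \<Rightarrow> (real \<Rightarrow> real \<Rightarrow> real) \<Rightarrow> (real \<times> (real \<Rightarrow> real)) set" where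
  "Sigma_set N \<delta> R \<alpha> f = RE_top \<delta> R closure_of nontrivial_solutions N \<delta> R \<alpha> f"

definition joins_with_infinity ::
  "real \<Rightarrow> real \<Rightarrow> (real \<times> (real \<Rightarrow> real)) set \<Rightarrow> real \<Rightarrow> bool" where
  "joins_with_infinity \<delta> R \<zeta> l0 \<longleftrightarrow>
     (l0, E_zero \<delta> R) \<in> \<zeta> \<and> (\<forall>L. \<exists>(l, u)\<in>\<zeta>. l > L)"

text \<open>The filter of \<open>(\<lambda>, u) \<in> \<zeta>\<close> with \<open>\<lambda> \<rightarrow> \<infinity>\<close>.\<close>

definition lambda_to_infinity :: "(real \<times> (real \<Rightarrow> real)) set \<Rightarrow> (real \<times> (real \<Rightarrow> real)) filter" where
  "lambda_to_infinity \<zeta> = inf (filtercomap fst at_top) (principal \<zeta>)"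

text \<open>\<^const>\<open>Metric_space.mtopology\<close> is only meaningful for a metric, so we check that
  \<^const>\<open>E_dist\<close> is one.\<close>

lemma der_works:
  assumes "C1_on \<delta> R u" "r \<in> {\<delta>..R}"
  shows "(u has_vector_derivative der \<delta> R u r) (at r within {\<delta>..R})"
  using assms unfolding C1_on_def der_def differentiable_on_def
  by (auto simp: vector_derivative_works)

lemma der_eqI:
  assumes "(u has_vector_derivative d) (at r within {\<delta>..R})" "r \<in> {\<delta>..R}" "\<delta> < R"
  shows "der \<delta> R u r = d"
  using assms unfolding der_def by (metis box_real(2) vector_derivative_within_cbox)

lemma der_diff:
  assumes "C1_on \<delta> R u" "C1_on \<delta> R v" "\<delta> < R" "r \<in> {\<delta>..R}"
  shows "der \<delta> R (\<lambda>r. u r - v r) r = der \<delta> R u r - der \<delta> R v r"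
  using assms by (intro der_eqI has_vector_derivative_diff der_works) auto

lemma C1_on_continuous: "C1_on \<delta> R u \<Longrightarrow> continuous_on {\<delta>..R} u"
  unfolding C1_on_def by (auto intro: differentiable_imp_continuous_on)

lemma sup_norm_upper:
  assumes "continuous_on {\<delta>..R} g" "r \<in> {\<delta>..R}"
  shows "\<bar>g r\<bar> \<le> sup_norm \<delta> R g"
proof -
  have "compact ((\<lambda>r. \<bar>g r\<bar>) ` {\<delta>..R})"
    using assms(1) by (intro compact_continuous_image continuous_intros) auto
  then show ?thesis unfolding sup_norm_def
    using assms(2) by (intro cSUP_upper bounded_imp_bdd_above compact_imp_bounded)
qed

lemma sup_norm_least:
  assumes "\<delta> < R" "\<And>r. r \<in> {\<delta>..R} \<Longrightarrow> \<bar>g r\<bar> \<le> c"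
  shows "sup_norm \<delta> R g \<le> c"
  unfolding sup_norm_def using assms by (intro cSUP_least) auto

lemma E_dist_eq:
  assumes "u \<in> E_space \<delta> R" "v \<in> E_space \<delta> R" "\<delta> < R"
  shows "E_dist \<delta> R u v =
    sup_norm \<delta> R (\<lambda>r. u r - v r) + sup_norm \<delta> R (\<lambda>r. der \<delta> R u r - der \<delta> R v r)"
proof -
  have "sup_norm \<delta> R (der \<delta> R (\<lambda>r. u r - v r)) = sup_norm \<delta> R (\<lambda>r. der \<delta> R u r - der \<delta> R v r)"
    unfolding sup_norm_def using assms
    by (intro arg_cong[where f=Sup] image_cong) (auto simp: E_space_def der_diff)
  then show ?thesis using assms by (simp add: E_dist_def C1_norm_def)
qed

lemma Metric_space_E:
  assumes "\<delta> < R"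
  shows "Metric_space (E_space \<delta> R) (E_dist \<delta> R)"
proof -
  have c: "continuous_on {\<delta>..R} (\<lambda>r. u r - v r)"
      "continuous_on {\<delta>..R} (\<lambda>r. der \<delta> R u r - der \<delta> R v r)"
    if "u \<in> E_space \<delta> R" "v \<in> E_space \<delta> R" for u v
    using that C1_on_continuous unfolding E_space_def C1_on_def
    by (auto intro!: continuous_on_diff)
  have nonneg: "0 \<le> sup_norm \<delta> R g" if "continuous_on {\<delta>..R} g" for g
    using sup_norm_upper[OF that, of R] assms by auto
  have tri: "sup_norm \<delta> R (\<lambda>r. a r - e r) \<le> sup_norm \<delta> R (\<lambda>r. a r - b r) + sup_norm \<delta> R (\<lambda>r. b r - e r)"
    if "continuous_on {\<delta>..R} (\<lambda>r. a r - b r)" "continuous_on {\<delta>..R} (\<lambda>r. b r - e r)" for a b e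
  proof (rule sup_norm_least[OF assms])
    fix r assume "r \<in> {\<delta>..R}"
    from sup_norm_upper[OF that(1) this] sup_norm_upper[OF that(2) this]
    show "\<bar>a r - e r\<bar> \<le> sup_norm \<delta> R (\<lambda>r. a r - b r) + sup_norm \<delta> R (\<lambda>r. b r - e r)" by linarith
  qed
  have d_nonneg: "0 \<le> E_dist \<delta> R u v" if "u \<in> E_space \<delta> R" "v \<in> E_space \<delta> R" for u v
    using E_dist_eq[OF that assms] nonneg[OF c(1)[OF that]] nonneg[OF c(2)[OF that]] by simp
  have d_sym: "E_dist \<delta> R u v = E_dist \<delta> R v u"
    if "u \<in> E_space \<delta> R" "v \<in> E_space \<delta> R" for u v
    unfolding E_dist_eq[OF that assms] E_dist_eq[OF that(2,1) assms]
    by (simp add: sup_norm_def abs_minus_commute)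
  have d_zero: "E_dist \<delta> R u v = 0 \<longleftrightarrow> u = v"
    if u: "u \<in> E_space \<delta> R" and v: "v \<in> E_space \<delta> R" for u v
  proof
    assume "E_dist \<delta> R u v = 0"
    then have z: "sup_norm \<delta> R (\<lambda>r. u r - v r) = 0"
      using E_dist_eq[OF u v assms] nonneg[OF c(1)[OF u v]] nonneg[OF c(2)[OF u v]] by linarith
    have "u r = v r" if "r \<in> {\<delta>..R}" for r
      using sup_norm_upper[OF c(1)[OF u v] that] z by simp
    then show "u = v"
      using u v unfolding E_space_def by (auto intro: extensionalityI)
  next
    assume "u = v" then show "E_dist \<delta> R u v = 0"
      unfolding E_dist_eq[OF u v assms] sup_norm_def using assms by simp
  qed
  have "E_dist \<delta> R u w \<le> E_dist \<delta> R u v + E_dist \<delta> R v w"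
    if u: "u \<in> E_space \<delta> R" and v: "v \<in> E_space \<delta> R" and w: "w \<in> E_space \<delta> R" for u v w
    unfolding E_dist_eq[OF u v assms] E_dist_eq[OF v w assms] E_dist_eq[OF u w assms]
    using tri[OF c(1)[OF u v] c(1)[OF v w]] tri[OF c(2)[OF u v] c(2)[OF v w]] by linarith
  moreover have "0 \<le> E_dist \<delta> R u v" for u v
    using d_nonneg[of u v] by (cases "u \<in> E_space \<delta> R \<and> v \<in> E_space \<delta> R") (auto simp: E_dist_def)
  moreover have "E_dist \<delta> R u v = E_dist \<delta> R v u" for u v
    using d_sym[of u v] by (cases "u \<in> E_space \<delta> R \<and> v \<in> E_space \<delta> R") (auto simp: E_dist_def)
  ultimately show ?thesis
    using d_zero by unfold_locales
qed

end

theory Submission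
  imports Defs "HOL-Complex_Analysis.Great_Picard"
begin

text \<open>
  Put \<open>v = -u'\<close>. The inverse of \<open>\<phi>\<^sub>1\<close> is
  \<open>y \<mapsto> y / sqrt (1 + y\<^sup>2)\<close>, so integrating the equation once turns (P) into
  \<open>v t = \<phi>\<^sub>1\<^sup>-\<^sup>1 (\<lambda> / t\<^bsup>N-1\<^esup> * \<integral>\<^bsub>\<delta>..t\<^esub> s\<^bsup>N-1\<^esup> f(s, u s) ds)\<close> with \<open>u r = \<integral>\<^bsub>r..R\<^esub> v\<close>. The \<open>C\<^sup>1\<close> topology for \<open>u\<close>
  is the uniform topology for \<open>v\<close>. Since \<open>0 \<le> v < 1\<close> holds automatically, \<open>u\<close> takes values in
  \<open>[0, R - \<delta>]\<close>, where \<open>f\<close> is bounded; hence for bounded \<open>\<lambda>\<close> the right-hand side maps into a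
  compact convex set of equi-Lipschitz functions.

  If a compact map depending on a parameter \<open>\<lambda> \<in> [0, b]\<close> has a
  single fixed point at \<open>\<lambda> = 0\<close>, then its fixed points contain a connected set joining \<open>\<lambda> = 0\<close> to
  \<open>\<lambda> = b\<close> (\<open>continuum_of_fixed_points\<close>). Otherwise the fixed points split into
  two compact pieces, one containing the bottom and one the top; sending the parameter itself to
  \<open>b\<close> on the first piece and to \<open>0\<close> on the second, and interpolating continuously elsewhere, gives
  a compact map without fixed points, against Schauder's theorem. Schauder's theorem comes from Brouwer's theorem on cubes of arbitrary
  finite dimension, and that from Kuhn's lemma.

  Applied to (P) as it stands, this could return the trivial solutions
  \<open>(\<lambda>, 0)\<close>. Therefore \<open>f(s, u s)\<close> is replaced by \<open>f(s, max (u s) (\<eta> \<lambda> * \<psi> s))\<close>, with a fixed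
  concave function \<open>\<psi>\<close> and an amplitude \<open>\<eta> \<lambda>\<close> that is continuous in \<open>\<lambda>\<close> and positive for
  \<open>\<lambda> > 0\<close>. Since \<open>f(r, s) / s\<close> blows up at \<open>0\<close>, the amplitude can be taken so small that each fixed
  point of the modified equation lies above the floor \<open>\<eta> \<lambda> * \<psi>\<close> (\<open>slope_floor\<close>) and each
  nontrivial solution of (P) does so too (\<open>K_intro\<close>). For \<open>\<lambda> > 0\<close> the modified equation thus has
  exactly the nontrivial solutions of (P), and for \<open>\<lambda> = 0\<close> it has only \<open>0\<close>. The set \<open>K\<close> of its
  fixed points is closed, so the corresponding functions \<open>u\<close> make up a set that contains \<open>\<Sigma>\<^sub>\<delta>\<close>. Joining the continua over \<open>[0, b]\<close> for all \<open>b\<close>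
  gives a connected set from \<open>(0, \<theta>)\<close> over all of \<open>[0, \<infinity>)\<close>, and the component is the one
  of \<open>(0, \<theta>)\<close>. Positivity in the interior of the cone is the floor again.

  The amplitude \<open>\<eta>\<close> is bounded below on \<open>[1, \<infinity>)\<close>, hence so is
  \<open>f(s, u s)\<close> near \<open>s = \<delta>\<close>. The argument of \<open>\<phi>\<^sub>1\<^sup>-\<^sup>1\<close> then tends to infinity with \<open>\<lambda>\<close>, uniformly for
  \<open>t \<ge> \<delta> + e\<close>, and \<open>u' \<rightarrow> -1\<close> uniformly there (\<open>K_asymptotic\<close>). Both limits follow from this.
\<close>

section \<open>Connected sets of fixed points of compact maps\<close>

text \<open>The remaining coordinates are pinned to \<open>0\<close> so that the cube is compact in the product topology; the
dimension \<open>n\<close> is a number here, as Schauder's theorem needs it to be chosen inside a proof.\<close>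

definition nat_cube :: "nat \<Rightarrow> (nat \<Rightarrow> real) set" where
  "nat_cube n = {x. (\<forall>i<n. 0 \<le> x i \<and> x i \<le> 1) \<and> (\<forall>i\<ge>n. x i = 0)}"

text \<open>Label a grid point in direction \<open>i\<close> by whether \<open>F\<close> moves it up or down in that coordinate. Kuhn's
lemma gives grid cells in which both labels occur in every direction; the cells of ever finer grids
accumulate at a point, and continuity forces \<open>F x i \<ge> x i\<close> and \<open>F x i \<le> x i\<close> there.\<close>

theorem brouwer_nat_cube:
  fixes F :: "(nat \<Rightarrow> real) \<Rightarrow> nat \<Rightarrow> real"
  assumes cont: "\<And>i. i < n \<Longrightarrow> continuous_on (nat_cube n) (\<lambda>x. F x i)"
    and range: "\<And>x i. x \<in> nat_cube n \<Longrightarrow> i < n \<Longrightarrow> 0 \<le> F x i \<and> F x i \<le> 1"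
  obtains x where "x \<in> nat_cube n" "\<forall>i<n. F x i = x i"
proof -
  define Q where "Q = nat_cube n"
  note cont = cont[folded Q_def] and range = range[folded Q_def]
  define z where "z p q i = (if i < n then real (q i) / real (Suc p) else 0)" for p and q :: "nat \<Rightarrow> nat" and i
  define label where "label p q i = (if q i = 0 then 0 else if q i = Suc p then 1
      else if F (z p q) i \<ge> z p q i then 0 else (1::nat))" for p q i
  have zQ: "z p q \<in> Q" if "\<forall>i<n. q i \<le> Suc p" for p q
    using that unfolding Q_def nat_cube_def z_def by (auto simp: divide_simps)
  have low: "z p q i \<le> F (z p q) i" if "\<forall>i<n. q i \<le> Suc p" "i < n" "label p q i = 0" for p q i
    using that range[OF zQ[OF that(1)] that(2)] unfolding label_def
    by (auto split: if_splits simp: z_def)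
  have high: "F (z p q) i \<le> z p q i" if "\<forall>i<n. q i \<le> Suc p" "i < n" "label p q i \<noteq> 0" for p q i
    using that range[OF zQ[OF that(1)] that(2)] unfolding label_def
    by (auto split: if_splits simp: z_def)
  define cell where "cell q c \<longleftrightarrow> (\<forall>j<n. q j \<le> c j \<and> c j \<le> q j + 1)" for q c :: "nat \<Rightarrow> nat"
  have "\<exists>q. (\<forall>i<n. q i < Suc p) \<and>
      (\<forall>i<n. \<exists>a b. cell q a \<and> cell q b \<and> label p a i = 0 \<and> label p b i \<noteq> 0)" for p
  proof -
    obtain q where q: "\<forall>i<n. q i < Suc p"
      and rs: "\<forall>i<n. \<exists>r s. (\<forall>j<n. q j \<le> r j \<and> r j \<le> q j + 1) \<and>
        (\<forall>j<n. q j \<le> s j \<and> s j \<le> q j + 1) \<and> label p r i \<noteq> label p s i"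
      by (rule kuhn_lemma[of "Suc p" n "label p"]) (auto simp: label_def)
    have "\<exists>a b. cell q a \<and> cell q b \<and> label p a i = 0 \<and> label p b i \<noteq> 0" if i: "i < n" for i
    proof -
      obtain r s where 1: "cell q r" and 2: "cell q s" and 3: "label p r i \<noteq> label p s i"
        using rs i unfolding cell_def by blast
      show ?thesis
      proof (cases "label p r i = 0")
        case True then show ?thesis using 1 2 3 by (intro exI[of _ r] exI[of _ s]) auto
      next
        case False
        then have "label p s i = 0" using 3 by (auto simp: label_def split: if_splits)
        then show ?thesis using 1 2 False by (intro exI[of _ s] exI[of _ r]) auto
      qed
    qed
    then show ?thesis using q by blast
  qed
  then obtain q where q: "\<And>p i. i < n \<Longrightarrow> q p i < Suc p"
    and ab: "\<And>p i. i < n \<Longrightarrow> \<exists>a b. cell (q p) a \<and> cell (q p) b \<and> label p a i = 0 \<and> label p b i \<noteq> 0"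
    by metis
  have "Q = PiE UNIV (\<lambda>i. if i < n then {0..1} else {0})"
    by (auto simp: Q_def nat_cube_def PiE_iff split: if_splits)
  moreover have "compactin (product_topology (\<lambda>i. euclidean) UNIV) (PiE UNIV (\<lambda>i::nat. if i < n then {0..1::real} else {0}))"
    unfolding compactin_PiE by (auto simp: PiE_eq_empty_iff)
  ultimately have "compact Q"
    by (simp add: euclidean_product_topology)
  then have "seq_compact Q" by (simp add: compact_eq_seq_compact_metric)
  moreover have "\<forall>p. z p (q p) \<in> Q" using q by (auto intro!: zQ less_imp_le)
  ultimately obtain x k where x: "x \<in> Q" and k: "strict_mono k" and lim: "((\<lambda>p. z p (q p)) \<circ> k) \<longlonglongrightarrow> x"
    unfolding seq_compact_def by meson
  have coord: "(\<lambda>m. g m j) \<longlonglongrightarrow> y j" if "g \<longlonglongrightarrow> y" for g and y :: "nat \<Rightarrow> real" and j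
    using continuous_on_tendsto_compose[OF continuous_on_product_coordinates that] by simp
  have inv: "(\<lambda>m. inverse (real (Suc (k m)))) \<longlonglongrightarrow> 0"
    using LIMSEQ_subseq_LIMSEQ[OF LIMSEQ_inverse_real_of_nat k] by (simp add: o_def)
  \<comment> \<open>vertices of the Kuhn simplices converge to the same limit as their base points\<close>
  have near: "(\<lambda>m. z (k m) (c (k m))) \<longlonglongrightarrow> x"
    if c: "\<And>p j. j < n \<Longrightarrow> q p j \<le> c p j \<and> c p j \<le> q p j + 1" for c
  proof -
    have "(\<lambda>m. z (k m) (c (k m)) j) \<longlonglongrightarrow> x j" for j
    proof -
      have "(\<lambda>m. z (k m) (c (k m)) j - z (k m) (q (k m)) j) \<longlonglongrightarrow> 0"
      proof (rule tendsto_rabs_zero_cancel, rule tendsto_sandwich[OF _ _ tendsto_const inv])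
        have "\<bar>z p (c p) j - z p (q p) j\<bar> \<le> inverse (real (Suc p))" for p
          using c[of j p] by (auto simp: z_def divide_simps)
        then show "\<forall>\<^sub>F m in sequentially. \<bar>z (k m) (c (k m)) j - z (k m) (q (k m)) j\<bar> \<le> inverse (real (Suc (k m)))"
          by simp
      qed simp
      from tendsto_add[OF this coord[OF lim, of j]] show ?thesis by (simp add: o_def)
    qed
    then have "limitin (product_topology (\<lambda>i. euclidean) UNIV) (\<lambda>m. z (k m) (c (k m))) x sequentially"
      unfolding limitin_componentwise by simp
    then show ?thesis by (simp add: euclidean_product_topology)
  qed
  have "F x i = x i" if i: "i < n" for i
  proof (rule antisym)
    have "\<forall>p. \<exists>c. cell (q p) (fst c) \<and> cell (q p) (snd c) \<and> label p (fst c) i = 0 \<and> label p (snd c) i \<noteq> 0"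
      using ab[OF i] by simp
    then obtain c where c: "\<forall>p. cell (q p) (fst (c p)) \<and> cell (q p) (snd (c p)) \<and> label p (fst (c p)) i = 0 \<and> label p (snd (c p)) i \<noteq> 0"
      by (rule choice[THEN exE]) blast
    define a b where "a p = fst (c p)" and "b p = snd (c p)" for p
    have a: "q p j \<le> a p j \<and> a p j \<le> q p j + 1" and b: "q p j \<le> b p j \<and> b p j \<le> q p j + 1" if "j < n" for p j
      using c that by (auto simp: a_def b_def cell_def)
    have la: "label p (a p) i = 0" and lb: "label p (b p) i \<noteq> 0" for p
      using c by (auto simp: a_def b_def)
    have aQ: "\<forall>j<n. a p j \<le> Suc p" and bQ: "\<forall>j<n. b p j \<le> Suc p" for p
    proof -
      have "a p j \<le> Suc p \<and> b p j \<le> Suc p" if "j < n" for j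
        using a[OF that, of p] b[OF that, of p] q[OF that, of p] by linarith
      then show "\<forall>j<n. a p j \<le> Suc p" "\<forall>j<n. b p j \<le> Suc p" by blast+
    qed
    have lima: "(\<lambda>m. z (k m) (a (k m))) \<longlonglongrightarrow> x" and limb: "(\<lambda>m. z (k m) (b (k m))) \<longlonglongrightarrow> x"
      using near[of a, OF a] near[of b, OF b] by auto
    have Fl: "(\<lambda>m. F (g m) i) \<longlonglongrightarrow> F x i" if "g \<longlonglongrightarrow> x" "\<And>m. g m \<in> Q" for g
      using continuous_on_tendsto_compose[OF cont[OF i] that(1) x] that(2) by simp
    show "x i \<le> F x i"
      using LIMSEQ_le[OF coord[OF lima, of i] Fl[OF lima zQ[OF aQ]]] low[OF aQ i la] by blast
    show "F x i \<le> x i"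
      using LIMSEQ_le[OF Fl[OF limb zQ[OF bQ]] coord[OF limb, of i]] high[OF bQ i lb] by blast
  qed
  then show thesis using x that unfolding Q_def by blast
qed

text \<open>Take a finite \<open>e\<close>-net \<open>y\<^sub>0, \<dots>, y\<^bsub>n-1\<^esub>\<close> of \<open>K\<close> and the partition of unity \<open>w i / W\<close> subordinate to it.
Brouwer's theorem is applied to \<open>x \<mapsto> (weights of f (p x))\<close>, where \<open>p\<close> maps the cube into \<open>K\<close> and
is the usual combination \<open>\<Sum> x\<^sub>i y\<^sub>i\<close> on the standard simplex. A fixed point has coordinate sum \<open>1\<close>,
so \<open>p x\<close> is the average of net points near \<open>f (p x)\<close>, that is, \<open>p x\<close> is moved by at most \<open>e\<close>.
Compactness turns approximate fixed points into a fixed point.\<close>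

theorem schauder:
  fixes f :: "'a::real_normed_vector \<Rightarrow> 'a"
  assumes K: "compact K" "convex K" "K \<noteq> {}" and cont: "continuous_on K f" and maps: "f \<in> K \<rightarrow> K"
  obtains x where "x \<in> K" "f x = x"
proof -
  have approx: "\<exists>x\<in>K. dist (f x) x \<le> e" if e: "e > 0" for e
  proof -
    obtain k where "finite k" "k \<subseteq> K" and cover: "K \<subseteq> (\<Union>y\<in>k. ball y e)"
      using compactE_image[OF K(1), of K "\<lambda>y. ball y e"] e by (metis UN_I centre_in_ball open_ball subsetI)
    then obtain y :: "nat \<Rightarrow> 'a" and n where y: "k = y ` {..<n}"
      by (metis finite_imp_nat_seg_image_inj_on lessThan_def)
    have yK: "y i \<in> K" if "i < n" for i using that y \<open>k \<subseteq> K\<close> by auto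
    have n: "0 < n" using cover y K(3) by (cases n) auto
    define w where "w i z = max 0 (e - dist z (y i))" for i z
    define W where "W z = (\<Sum>i<n. w i z)" for z
    \<comment> \<open>The coefficients of \<open>p x\<close>: normalised if the sum of the coordinates exceeds \<open>1\<close>, and with the
      missing mass put on \<open>y 0\<close> if it falls short, so that \<open>p\<close> is defined on the whole cube.\<close>
    define c where "c x i = (x i + (if i = 0 then 1 else 0) * max 0 (1 - (\<Sum>j<n. x j))) / max 1 (\<Sum>j<n. x j)" for x :: "nat \<Rightarrow> real" and i
    define p where "p x = (\<Sum>i<n. c x i *\<^sub>R y i)" for x
    define F where "F x i = w i (f (p x)) / W (f (p x))" for x i
    have W: "W z > 0" if z: "z \<in> K" for z
    proof -
      obtain i where "i < n" "z \<in> ball (y i) e" using cover z y by blast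
      then show ?thesis unfolding W_def by (intro sum_pos2[of "{..<n}" i]) (auto simp: w_def dist_commute)
    qed
    have c_sum: "(\<Sum>i<n. c x i) = 1" for x
    proof -
      have "(\<Sum>i<n. c x i) = ((\<Sum>i<n. x i) + max 0 (1 - (\<Sum>i<n. x i))) / max 1 (\<Sum>i<n. x i)"
        unfolding c_def sum_divide_distrib[symmetric] using n by (simp add: sum.distrib sum_distrib_right[symmetric])
      then show ?thesis by (simp add: max_def)
    qed
    have pK: "p x \<in> K" if "x \<in> nat_cube n" for x
      unfolding p_def
    proof (rule convex_sum[OF _ K(2) c_sum])
      show "0 \<le> c x i" if "i \<in> {..<n}" for i
        using \<open>x \<in> nat_cube n\<close> that by (auto simp: c_def nat_cube_def intro!: divide_nonneg_pos add_nonneg_nonneg)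
    qed (use yK in auto)
    have fpK: "f (p x) \<in> K" if "x \<in> nat_cube n" for x using pK[OF that] maps by auto
    have "continuous_on (nat_cube n) p"
      unfolding p_def c_def
      by (auto intro!: continuous_intros continuous_on_subset[OF continuous_on_product_coordinates])
    then have cfp: "continuous_on (nat_cube n) (\<lambda>x. f (p x))"
      using pK by (intro continuous_on_compose2[OF cont]) auto
    have cF: "continuous_on (nat_cube n) (\<lambda>x. F x i)" for i
      unfolding F_def w_def W_def
      by (intro continuous_intros cfp) (use W fpK in \<open>force simp: W_def w_def\<close>)
    have "0 \<le> F x i \<and> F x i \<le> 1" if "x \<in> nat_cube n" "i < n" for x i
    proof -
      have "w i (f (p x)) \<le> W (f (p x))"
        unfolding W_def using that(2) by (intro member_le_sum) (auto simp: w_def)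
      then show ?thesis using W[OF fpK[OF that(1)]] by (auto simp: F_def w_def)
    qed
    then obtain x where x: "x \<in> nat_cube n" and Fx: "\<forall>i<n. F x i = x i"
      using brouwer_nat_cube[of n F] cF by blast
    define z where "z = f (p x)"
    have Wz: "W z > 0" using W fpK[OF x] by (simp add: z_def)
    have s1: "(\<Sum>i<n. F x i) = 1"
      unfolding F_def sum_divide_distrib[symmetric] using Wz by (simp add: W_def z_def)
    then have "(\<Sum>i<n. x i) = 1" using Fx by simp
    then have "c x i = F x i" if "i < n" for i using Fx that by (simp add: c_def)
    then have px: "p x = (\<Sum>i<n. F x i *\<^sub>R y i)" by (simp add: p_def)
    have "z - p x = (\<Sum>i<n. F x i *\<^sub>R (z - y i))"
      unfolding px scaleR_diff_right sum_subtractf scaleR_left.sum[symmetric] s1 by simp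
    also have "norm \<dots> \<le> (\<Sum>i<n. F x i * e)"
    proof (rule sum_norm_le)
      fix i
      have "w i z * norm (z - y i) \<le> w i z * e"
        by (auto simp: w_def max_def dist_norm intro!: mult_left_mono)
      then show "norm (F x i *\<^sub>R (z - y i)) \<le> F x i * e"
        using Wz by (simp add: F_def z_def[symmetric] divide_right_mono w_def)
    qed
    also have "\<dots> = e" using s1 by (simp flip: sum_distrib_right)
    finally show ?thesis using pK[OF x] by (auto simp: z_def dist_norm)
  qed
  have "continuous_on K (\<lambda>x. dist (f x) x)" by (intro continuous_intros cont)
  from continuous_attains_inf[OF K(1,3) this]
  obtain x where x: "x \<in> K" and min: "\<And>y. y \<in> K \<Longrightarrow> dist (f x) x \<le> dist (f y) y" by blast
  have "dist (f x) x \<le> e" if "e > 0" for e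
    using approx[OF that] min by (blast intro: order_trans)
  then have "dist (f x) x \<le> 0" by (rule field_le_epsilon[of _ 0, simplified])
  then show thesis using x that by simp
qed

text \<open>Let \<open>S\<close> be the component of \<open>(a, x0)\<close> in the compact set of all fixed points. If it misses the fixed
points with parameter \<open>b\<close>, the fixed points split into two disjoint closed sets \<open>U\<close>, containing
\<open>S\<close>, and \<open>V\<close>, containing the ones at \<open>b\<close>. Let the parameter coordinate be mapped to \<open>b\<close> on \<open>U\<close> and
to \<open>a\<close> on \<open>V\<close>. A fixed point of the resulting self-map of \<open>[a, b] \<times> C\<close> would lie over \<open>b\<close> if it
is in \<open>U\<close> and would be \<open>(a, x0)\<close> if it is in \<open>V\<close>; neither is possible.\<close>

theorem continuum_of_fixed_points:
  fixes H :: "real \<Rightarrow> 'a::real_normed_vector \<Rightarrow> 'a"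
  assumes ab: "a \<le> b" and C: "compact C" "convex C"
    and cont: "continuous_on ({a..b} \<times> C) (\<lambda>(t, x). H t x)"
    and maps: "\<And>t x. t \<in> {a..b} \<Longrightarrow> x \<in> C \<Longrightarrow> H t x \<in> C"
    and x0: "x0 \<in> C" "H a x0 = x0" and unique: "\<And>x. x \<in> C \<Longrightarrow> H a x = x \<Longrightarrow> x = x0"
  obtains S where "connected S" "S \<subseteq> {(t, x). t \<in> {a..b} \<and> x \<in> C \<and> H t x = x}"
    "(a, x0) \<in> S" "\<exists>x. (b, x) \<in> S"
proof -
  define K where "K = {z \<in> {a..b} \<times> C. H (fst z) (snd z) = snd z}"
  have cont': "continuous_on ({a..b} \<times> C) (\<lambda>z. H (fst z) (snd z))"
    using cont by (simp add: case_prod_unfold)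
  have dom: "compact ({a..b} \<times> C)" "convex ({a..b} \<times> C)" using C by (auto intro: compact_Times convex_Times)
  have "K = ({a..b} \<times> C) \<inter> (\<lambda>z. H (fst z) (snd z) - snd z) -` {0}" by (auto simp: K_def)
  moreover have "closed (({a..b} \<times> C) \<inter> (\<lambda>z. H (fst z) (snd z) - snd z) -` {0})"
    by (intro continuous_closed_preimage continuous_intros cont' compact_imp_closed[OF dom(1)])
  ultimately have "closed K" by simp
  then have "compact (({a..b} \<times> C) \<inter> K)" by (rule compact_Int_closed[OF dom(1)])
  moreover have "K = ({a..b} \<times> C) \<inter> K" by (auto simp: K_def)
  ultimately have "compact K" by simp
  define X where "X = top_of_set K"
  define T where "T = {z \<in> K. fst z = b}"
  define S where "S = connected_component_of_set X (a, x0)"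
  have K0: "(a, x0) \<in> K" using x0 ab by (auto simp: K_def)
  have Scomp: "S \<in> connected_components_of X"
    using K0 unfolding S_def X_def connected_components_of_def by auto
  have SX: "S \<subseteq> K" using connected_component_of_subset_topspace[of X] by (auto simp: S_def X_def)
  have conS: "connected S"
    using connectedin_connected_components_of[OF Scomp] by (auto simp: X_def connectedin_subtopology)
  have aS: "(a, x0) \<in> S" using K0 by (simp add: S_def X_def connected_component_of_refl)
  have "continuous_on C (H b)"
    using ab by (intro continuous_on_compose2[OF cont', of _ "\<lambda>x. (b, x)", simplified] continuous_intros) auto
  then obtain xb where "xb \<in> C" "H b xb = xb"
    using schauder[of C "H b"] C x0 maps ab by auto
  then have Tne: "(b, xb) \<in> T" using ab by (auto simp: T_def K_def)
  have "\<not> disjnt S T"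
  proof
    assume "disjnt S T"
    have "closedin X T" unfolding X_def T_def
      by (rule closedin_closed_subset[of UNIV "{z. fst z = b}"]) (auto simp: closed_Collect_eq continuous_intros)
    moreover have "compactin X S"
      using closedin_connected_components_of[OF Scomp] \<open>compact K\<close>
      by (simp add: X_def closedin_compact_space compact_space_subtopology closedin_compact)
    ultimately have "separated_between X S T"
      using Scomp \<open>disjnt S T\<close> \<open>compact K\<close>
      by (intro separated_between_compact_connected_component)
        (auto simp: X_def Hausdorff_space_subtopology compact_space_subtopology intro!: compact_imp_locally_compact_space)
    then obtain U V where U: "closedin X U" and V: "closedin X V" and UV: "U \<union> V = K" "U \<inter> V = {}" "S \<subseteq> U" "T \<subseteq> V"
      unfolding separated_between_alt X_def by (auto simp: disjnt_def)
    have cl: "closed U" "closed V"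
      using U V \<open>closed K\<close> by (auto simp: X_def closedin_closed_trans)
    have ne: "U \<noteq> {}" "V \<noteq> {}" using aS Tne UV by auto
    \<comment> \<open>A continuous function that is \<open>1\<close> on \<open>U\<close> and \<open>0\<close> on \<open>V\<close>.\<close>
    define q where "q z = infdist z V / (infdist z U + infdist z V)" for z
    have pos: "infdist z U + infdist z V > 0" for z
      using infdist_nonneg[of z U] infdist_nonneg[of z V] in_closed_iff_infdist_zero[OF cl(1) ne(1), of z]
        in_closed_iff_infdist_zero[OF cl(2) ne(2), of z] UV(2) by (metis add_nonneg_eq_0_iff add_nonneg_nonneg disjoint_iff less_eq_real_def)
    have q01: "0 \<le> q z" "q z \<le> 1" for z
      using pos[of z] infdist_nonneg[of z U] infdist_nonneg[of z V] by (auto simp: q_def)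
    define G where "G z = (a + (b - a) * q z, H (fst z) (snd z))" for z
    have "continuous_on ({a..b} \<times> C) G"
      unfolding G_def q_def using pos by (intro continuous_intros cont') (auto simp: less_imp_neq[symmetric])
    moreover have "G \<in> {a..b} \<times> C \<rightarrow> {a..b} \<times> C"
    proof
      fix z assume z: "z \<in> {a..b} \<times> C"
      have "(b - a) * q z \<le> (b - a) * 1" "0 \<le> (b - a) * q z" using q01[of z] ab by (intro mult_left_mono mult_nonneg_nonneg; simp)+
      then show "G z \<in> {a..b} \<times> C" using maps z by (auto simp: G_def)
    qed
    ultimately obtain z where z: "z \<in> {a..b} \<times> C" "G z = z"
      using schauder[OF dom, of G] x0 ab by auto
    then have zK: "z \<in> K" and qz: "a + (b - a) * q z = fst z"
      by (auto simp: K_def G_def prod_eq_iff)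
    show False
    proof (cases "z \<in> U")
      case True
      then have "q z = 1" using pos[of z] by (simp add: q_def)
      then have "z \<in> T" using qz zK by (simp add: T_def)
      then show False using True UV by auto
    next
      case False
      then have "z \<in> V" using zK UV by auto
      then have "q z = 0" by (simp add: q_def)
      then have "fst z = a" using qz by simp
      then have "z = (a, x0)" using zK unique[of "snd z"] by (auto simp: K_def prod_eq_iff)
      then show False using False aS UV by auto
    qed
  qed
  then have "\<exists>x. (b, x) \<in> S" by (auto simp: disjnt_iff T_def)
  moreover have "S \<subseteq> {(t, x). t \<in> {a..b} \<and> x \<in> C \<and> H t x = x}" using SX by (auto simp: K_def)
  ultimately show thesis using conS aS that by blast
qed

section \<open>The inverse of \<open>\<phi>\<^sub>1\<close>, radial averages and equi-Lipschitz functions\<close>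

definition phi1_inv :: "real \<Rightarrow> real" where
  "phi1_inv y = y / sqrt (1 + y\<^sup>2)"

lemma phi1_inv_abs_less: "\<bar>phi1_inv y\<bar> < 1"
proof -
  have "\<bar>y\<bar> < sqrt (1 + y\<^sup>2)" by (rule real_less_rsqrt) simp
  moreover have "0 < sqrt (1 + y\<^sup>2)" by (simp add: add_pos_nonneg)
  ultimately show ?thesis unfolding phi1_inv_def abs_divide by (simp add: divide_less_eq)
qed

lemma phi1_phi1_inv: "phi1 (phi1_inv y) = y"
proof -
  have p: "1 + y\<^sup>2 > 0" by (simp add: add_pos_nonneg)
  have "1 - (phi1_inv y)\<^sup>2 = 1 / (1 + y\<^sup>2)"
    using p by (simp add: phi1_inv_def power_divide field_simps)
  then show ?thesis using p by (simp add: phi1_def phi1_inv_def real_sqrt_divide)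
qed

lemma phi1_inv_phi1: assumes "\<bar>s\<bar> < 1" shows "phi1_inv (phi1 s) = s"
proof -
  have p: "1 - s\<^sup>2 > 0" using assms by (simp add: abs_square_less_1)
  have "1 + (phi1 s)\<^sup>2 = 1 / (1 - s\<^sup>2)" using p by (simp add: phi1_def power_divide field_simps)
  then show ?thesis using p by (simp add: phi1_def phi1_inv_def real_sqrt_divide)
qed

lemma phi1_minus: "phi1 (- s) = - phi1 s" by (simp add: phi1_def)

lemma phi1_inv_minus: "phi1_inv (- s) = - phi1_inv s" by (simp add: phi1_inv_def)

lemma phi1_inv_0 [simp]: "phi1_inv 0 = 0" by (simp add: phi1_inv_def)

lemma phi1_inv_DERIV: "(phi1_inv has_real_derivative cos (arctan y) * inverse (1 + y\<^sup>2)) (at y)"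
proof -
  have "phi1_inv = (\<lambda>y. sin (arctan y))" by (auto simp: phi1_inv_def sin_arctan)
  show ?thesis unfolding \<open>phi1_inv = _\<close> by (auto intro!: derivative_eq_intros)
qed

lemma phi1_inv_strict_mono: assumes "x < y" shows "phi1_inv x < phi1_inv y"
proof (rule DERIV_pos_imp_increasing[OF assms])
  fix z show "\<exists>d. (phi1_inv has_real_derivative d) (at z) \<and> 0 < d"
    using phi1_inv_DERIV[of z] cos_arctan_not_zero
    by (intro exI[of _ "cos (arctan z) * inverse (1 + z\<^sup>2)"]) (auto simp: cos_arctan add_pos_nonneg)
qed

lemma phi1_inv_mono: "x \<le> y \<Longrightarrow> phi1_inv x \<le> phi1_inv y"
  using phi1_inv_strict_mono[of x y] by (cases "x = y") auto

lemma phi1_inv_nonneg: "0 \<le> y \<Longrightarrow> 0 \<le> phi1_inv y"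
  by (simp add: phi1_inv_def)

lemma phi1_inv_lipschitz: "\<bar>phi1_inv x - phi1_inv y\<bar> \<le> \<bar>x - y\<bar>"
proof -
  have "norm (phi1_inv x - phi1_inv y) \<le> 1 * norm (x - y)"
  proof (rule field_differentiable_bound[OF convex_UNIV])
    fix z show "norm (cos (arctan z) * inverse (1 + z\<^sup>2)) \<le> 1"
      unfolding norm_mult by (rule mult_le_one) (auto simp: inverse_le_1_iff add_pos_nonneg)
  qed (auto intro: phi1_inv_DERIV)
  then show ?thesis by simp
qed

text \<open>This is the gain behind the floor: a floor of amplitude \<open>e\<close> will produce an argument of at least \<open>2 * e\<close>,
and hence slopes that exceed \<open>e\<close>.\<close>

lemma phi1_inv_double_ge:
  assumes "0 \<le> e" "e \<le> 1/2"
  shows "e \<le> phi1_inv (2 * e)" "0 < e \<Longrightarrow> e < phi1_inv (2 * e)"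
proof -
  have "sqrt (1 + (2 * e)\<^sup>2) < 2"
    using power_mono[of "2*e" 1 2] assms by (intro real_less_lsqrt) auto
  then have *: "e * sqrt (1 + (2 * e)\<^sup>2) \<le> 2 * e" "0 < e \<Longrightarrow> e * sqrt (1 + (2 * e)\<^sup>2) < 2 * e"
    using assms by (auto simp: mult.commute[of 2] intro!: mult_left_mono mult_strict_left_mono)
  have p: "0 < sqrt (1 + (2 * e)\<^sup>2)" by (simp add: add_pos_nonneg)
  show "e \<le> phi1_inv (2 * e)" "0 < e \<Longrightarrow> e < phi1_inv (2 * e)"
    unfolding phi1_inv_def using * p by (simp_all add: pos_le_divide_eq pos_less_divide_eq)
qed

text \<open>For \<open>\<delta> = 0\<close> and \<open>N \<ge> 2\<close> the value at \<open>t = 0\<close> is \<open>0 / 0 = 0\<close>, which is the continuous extension for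
bounded \<open>g\<close>.\<close>

definition radial_avg :: "nat \<Rightarrow> real \<Rightarrow> (real \<Rightarrow> real) \<Rightarrow> real \<Rightarrow> real" where
  "radial_avg N \<delta> g t = integral {\<delta>..t} (\<lambda>s. s ^ (N - 1) * g s) / t ^ (N - 1)"

lemma radial_integrable:
  fixes g :: "real \<Rightarrow> real"
  assumes "continuous_on {a..b} g"
  shows "(\<lambda>s. s ^ n * g s) integrable_on {a..b}"
  by (intro integrable_continuous_interval continuous_intros assms)

lemma radial_integral_bound:
  fixes g :: "real \<Rightarrow> real"
  assumes "0 \<le> a" "a \<le> b" "continuous_on {a..b} g" "\<And>s. s \<in> {a..b} \<Longrightarrow> \<bar>g s\<bar> \<le> B"
  shows "\<bar>integral {a..b} (\<lambda>s. s ^ n * g s)\<bar> \<le> B * b ^ n * (b - a)"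
proof -
  have "\<bar>s ^ n * g s\<bar> \<le> B * b ^ n" if "s \<in> {a..b}" for s
  proof -
    have "s ^ n * \<bar>g s\<bar> \<le> b ^ n * B" using that assms by (intro mult_mono power_mono) auto
    then show ?thesis using that assms(1) by (simp add: abs_mult mult.commute)
  qed
  then have "norm (integral {a..b} (\<lambda>s. s ^ n * g s)) \<le> (B * b ^ n) * (b - a)"
    by (intro integral_bound assms continuous_intros) auto
  then show ?thesis by simp
qed

lemma radial_avg_bound:
  assumes "0 \<le> \<delta>" "\<delta> \<le> t" "continuous_on {\<delta>..t} g" "\<And>s. s \<in> {\<delta>..t} \<Longrightarrow> \<bar>g s\<bar> \<le> B"
  shows "\<bar>radial_avg N \<delta> g t\<bar> \<le> B * (t - \<delta>)"
proof (cases "t ^ (N - 1) = 0")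
  case True
  have "0 \<le> B" using assms(4)[of \<delta>] assms(2) abs_ge_zero[of "g \<delta>"] by (meson atLeastAtMost_iff order_refl order_trans)
  moreover have "radial_avg N \<delta> g t = 0" by (simp only: radial_avg_def True div_by_0)
  ultimately show ?thesis using assms(2) by simp
next
  case False
  then have "t ^ (N - 1) > 0" using assms(1,2) by (simp add: order_less_le)
  then show ?thesis using radial_integral_bound[OF assms, of "N - 1"]
    by (simp add: radial_avg_def abs_divide divide_le_eq mult_ac)
qed

lemma radial_avg_diff:
  assumes "continuous_on {\<delta>..t} g" "continuous_on {\<delta>..t} k"
  shows "radial_avg N \<delta> g t - radial_avg N \<delta> k t = radial_avg N \<delta> (\<lambda>s. g s - k s) t"
  unfolding radial_avg_def diff_divide_distrib[symmetric]
  using integral_diff[OF radial_integrable[OF assms(1)] radial_integrable[OF assms(2)], of "N - 1" "N - 1"]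
  by (simp add: algebra_simps)

lemma radial_avg_cmult: "c * radial_avg N \<delta> g t = radial_avg N \<delta> (\<lambda>s. c * g s) t"
proof -
  have "integral {\<delta>..t} (\<lambda>s. s ^ (N - 1) * (c * g s)) = integral {\<delta>..t} (\<lambda>s. c * (s ^ (N - 1) * g s))"
    by (simp add: mult_ac)
  then show ?thesis by (simp add: radial_avg_def integral_mult_right)
qed

lemma radial_avg_nonneg:
  assumes "0 \<le> \<delta>" "\<delta> \<le> t" "continuous_on {\<delta>..t} g" "\<And>s. s \<in> {\<delta>..t} \<Longrightarrow> 0 \<le> g s"
  shows "0 \<le> radial_avg N \<delta> g t"
  unfolding radial_avg_def using assms
  by (intro divide_nonneg_nonneg integral_nonneg zero_le_power radial_integrable) (auto intro!: mult_nonneg_nonneg)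

lemma radial_integral_ge:
  fixes g :: "real \<Rightarrow> real"
  assumes "0 \<le> a" "a \<le> b" "b \<le> t" "continuous_on {a..t} g"
    and "\<And>s. s \<in> {a..t} \<Longrightarrow> 0 \<le> g s" "\<And>s. s \<in> {a..b} \<Longrightarrow> c \<le> g s"
  shows "c * integral {a..b} (\<lambda>s. s ^ n) \<le> integral {a..t} (\<lambda>s. s ^ n * g s)"
proof -
  have g': "continuous_on {a..b} g" using assms(3,4) continuous_on_subset by fastforce
  have "c * integral {a..b} (\<lambda>s. s ^ n) = integral {a..b} (\<lambda>s. s ^ n * c)"
    by (simp add: integral_mult_left mult.commute)
  also have "\<dots> \<le> integral {a..b} (\<lambda>s. s ^ n * g s)"
    using assms by (intro integral_le radial_integrable g') (auto intro!: mult_left_mono)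
  also have "\<dots> \<le> integral {a..t} (\<lambda>s. s ^ n * g s)"
    using assms by (intro integral_subset_le radial_integrable g') auto
  finally show ?thesis .
qed

lemma radial_integral_pos:
  fixes a b :: real
  assumes "0 \<le> a" "a < b"
  shows "0 < integral {a..b} (\<lambda>s. s ^ n)"
proof -
  have "integral {a..b} (\<lambda>s. s ^ n) \<noteq> 0"
    using assms integral_eq_0_iff[of a b "\<lambda>s. s ^ n", OF continuous_on_power[OF continuous_on_id]]
    by (auto dest!: bspec[of _ _ b])
  moreover have "0 \<le> integral {a..b} (\<lambda>s. s ^ n)"
    using assms by (intro integral_nonneg integrable_continuous_interval continuous_intros) auto
  ultimately show ?thesis by simp
qed

text \<open>The singular weight does no harm. Writing \<open>Q\<close> for the integral up to \<open>t\<close> and \<open>D\<close> for the one over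
\<open>[t, t']\<close>, the increment is \<open>D / t'\<^sup>n - Q / t\<^sup>n * (1 - (t / t')\<^sup>n)\<close> with \<open>n = N - 1\<close>; here
\<open>\<bar>Q / t\<^sup>n\<bar> \<le> B t\<close>, and Bernoulli's inequality gives \<open>t (1 - (t / t')\<^sup>n) \<le> n (t' - t)\<close>.\<close>

lemma radial_avg_lipschitz:
  assumes "0 \<le> \<delta>" "\<delta> \<le> t" "t \<le> t'" "1 \<le> N"
    and g: "continuous_on {\<delta>..t'} g" and B: "\<And>s. s \<in> {\<delta>..t'} \<Longrightarrow> \<bar>g s\<bar> \<le> B"
  shows "\<bar>radial_avg N \<delta> g t' - radial_avg N \<delta> g t\<bar> \<le> real N * B * (t' - t)"
proof -
  have B0: "0 \<le> B" using B[of \<delta>] assms(2,3) abs_ge_zero[of "g \<delta>"] by (meson atLeastAtMost_iff order_refl order_trans)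
  show ?thesis
  proof (cases "t = 0")
    case True
    then have "\<delta> = 0" using assms by simp
    then have 0: "radial_avg N \<delta> g t = 0" using True by (simp add: radial_avg_def)
    have "\<bar>radial_avg N \<delta> g t'\<bar> \<le> 1 * (B * (t' - t))"
      using radial_avg_bound[of \<delta> t' g B N] assms g B True \<open>\<delta> = 0\<close> by simp
    also have "\<dots> \<le> real N * (B * (t' - t))"
      using B0 assms by (intro mult_right_mono mult_nonneg_nonneg) auto
    finally show ?thesis using 0 by (simp add: mult_ac)
  next
    case False
    then have t: "0 < t" "0 < t'" using assms by auto
    define n where "n = N - 1"
    define Q where "Q = integral {\<delta>..t} (\<lambda>s. s ^ n * g s)"
    define D where "D = integral {t..t'} (\<lambda>s. s ^ n * g s)"
    have g1: "continuous_on {\<delta>..t} g" and g2: "continuous_on {t..t'} g"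
      using g by (rule continuous_on_subset; use assms in auto)+
    have QD: "integral {\<delta>..t'} (\<lambda>s. s ^ n * g s) = Q + D"
      unfolding Q_def D_def using Henstock_Kurzweil_Integration.integral_combine[OF assms(2,3) radial_integrable[OF g, of n]] by simp
    have Qb: "\<bar>Q\<bar> \<le> B * t ^ n * (t - \<delta>)"
      unfolding Q_def using assms by (intro radial_integral_bound g1 B) auto
    have Db: "\<bar>D\<bar> \<le> B * t' ^ n * (t' - t)"
      unfolding D_def using assms by (intro radial_integral_bound g2 B) auto
    have D1: "\<bar>D / t' ^ n\<bar> \<le> B * (t' - t)"
      using Db t by (simp add: abs_divide divide_le_eq mult_ac)
    have "\<bar>Q / t ^ n\<bar> \<le> B * (t - \<delta>)" using Qb t by (simp add: abs_divide divide_le_eq mult_ac)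
    also have "\<dots> \<le> B * t" using B0 assms(1) by (intro mult_left_mono) auto
    finally have Q1: "\<bar>Q / t ^ n\<bar> \<le> B * t" .
    have "1 + real n * (t / t' - 1) \<le> (1 + (t / t' - 1)) ^ n"
      by (rule Bernoulli_inequality) (use t in simp)
    then have ber: "1 - (t / t') ^ n \<le> real n * (1 - t / t')" by (simp add: algebra_simps)
    have le1: "(t / t') ^ n \<le> 1" using t assms by (intro power_le_one) auto
    have "t * (1 - (t / t') ^ n) \<le> t * (real n * (1 - t / t'))" using ber t by (intro mult_left_mono) auto
    also have "\<dots> = real n * (t / t') * (t' - t)" using t by (simp add: field_simps)
    also have "\<dots> \<le> real n * 1 * (t' - t)" using t assms by (intro mult_right_mono mult_left_mono) auto
    finally have T: "t * (1 - (t / t') ^ n) \<le> real n * (t' - t)" by simp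
    have "(Q + D) / t' ^ n - Q / t ^ n = D / t' ^ n - Q / t ^ n * (1 - (t / t') ^ n)"
      using t by (simp add: field_simps power_divide)
    also have "\<bar>\<dots>\<bar> \<le> \<bar>D / t' ^ n\<bar> + \<bar>Q / t ^ n\<bar> * (1 - (t / t') ^ n)"
      using abs_triangle_ineq4[of "D / t' ^ n" "Q / t ^ n * (1 - (t / t') ^ n)"] le1 by (simp add: abs_mult)
    also have "\<dots> \<le> B * (t' - t) + (B * t) * (1 - (t / t') ^ n)"
      using D1 Q1 le1 by (intro add_mono mult_right_mono) auto
    also have "\<dots> \<le> B * (t' - t) + B * (real n * (t' - t))"
      using mult_left_mono[OF T B0] by (simp add: mult_ac)
    also have "\<dots> = real N * B * (t' - t)"
      using \<open>1 \<le> N\<close> by (simp add: n_def of_nat_diff algebra_simps)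
    finally show ?thesis unfolding radial_avg_def n_def[symmetric] QD Q_def[symmetric] .
  qed
qed

lemma radial_avg_cong:
  assumes "\<And>s. s \<in> {\<delta>..t} \<Longrightarrow> g s = k s"
  shows "radial_avg N \<delta> g t = radial_avg N \<delta> k t"
proof -
  have "integral {\<delta>..t} (\<lambda>s. s ^ (N - 1) * g s) = integral {\<delta>..t} (\<lambda>s. s ^ (N - 1) * k s)"
    using assms by (intro integral_cong) simp
  then show ?thesis by (simp only: radial_avg_def)
qed

text \<open>The Arzela-Ascoli theorem on \<open>[a, b]\<close>; the functions are constant on either side of the interval, so
uniform convergence there is convergence in the sup norm.\<close>

lemma compact_lipschitz_bcontfun:
  fixes a b c B L :: real
  assumes "a \<le> b"
  shows "compact {v :: real \<Rightarrow>\<^sub>C real. (\<forall>t. c \<le> v t \<and> v t \<le> B) \<and> (\<forall>t. v t = v (max a (min b t))) \<and>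
      (\<forall>s t. \<bar>v s - v t\<bar> \<le> L * \<bar>s - t\<bar>)}" (is "compact ?C")
  unfolding compact_eq_seq_compact_metric
proof (rule seq_compactI)
  fix F :: "nat \<Rightarrow> real \<Rightarrow>\<^sub>C real"
  assume F: "\<forall>n. F n \<in> ?C"
  have "\<bar>F 0 0 - F 0 1\<bar> \<le> L * \<bar>0 - 1\<bar>" using F by blast
  then have L: "0 \<le> L" using abs_ge_zero[of "F 0 0 - F 0 1"] by simp
  obtain g k where g: "continuous_on {a..b} g" and k: "strict_mono (k :: nat \<Rightarrow> nat)"
    and lim: "\<And>e. 0 < e \<Longrightarrow> \<exists>M. \<forall>n x. M \<le> n \<and> x \<in> {a..b} \<longrightarrow> norm (F (k n) x - g x) < e"
  proof (rule Arzela_Ascoli[of "{a..b}" "\<lambda>n x. F n x" "max \<bar>c\<bar> \<bar>B\<bar>"])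
    show "norm (F n x) \<le> max \<bar>c\<bar> \<bar>B\<bar>" for n x
    proof -
      have "c \<le> F n x \<and> F n x \<le> B" using F by auto
      then show ?thesis by (simp add: max_def abs_if)
    qed
    show "\<exists>d>0. \<forall>n y. y \<in> {a..b} \<and> norm (x - y) < d \<longrightarrow> norm (F n x - F n y) < e" if "0 < e" for x e :: real
    proof (intro exI[of _ "e / (L + 1)"] conjI allI impI)
      show "0 < e / (L + 1)" using that L by simp
      fix n y assume y: "y \<in> {a..b} \<and> norm (x - y) < e / (L + 1)"
      have "\<bar>F n x - F n y\<bar> \<le> L * \<bar>x - y\<bar>" using F by auto
      also have "\<dots> \<le> (L + 1) * \<bar>x - y\<bar>" by (intro mult_right_mono) auto
      also have "\<dots> < e" using y L by (simp add: less_divide_eq mult.commute)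
      finally show "norm (F n x - F n y) < e" by simp
    qed
  qed (use F in auto)
  define G where "G t = g (max a (min b t))" for t
  have unif: "uniform_limit UNIV (\<lambda>n. apply_bcontfun (F (k n))) G sequentially"
  proof (rule uniform_limitI)
    fix e :: real assume "0 < e"
    then obtain M where M: "\<And>n x. M \<le> n \<Longrightarrow> x \<in> {a..b} \<Longrightarrow> norm (F (k n) x - g x) < e" using lim by blast
    have "dist (F (k n) x) (G x) < e" if "M \<le> n" for n x
    proof -
      have "F (k n) x = F (k n) (max a (min b x))" using F by auto
      then show ?thesis using M[OF that, of "max a (min b x)"] assms by (auto simp: G_def dist_norm)
    qed
    then show "\<forall>\<^sub>F n in sequentially. \<forall>x\<in>UNIV. dist (F (k n) x) (G x) < e"
      unfolding eventually_sequentially by blast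
  qed
  then obtain v where v: "G = apply_bcontfun v" "(\<lambda>n. F (k n)) \<longlonglongrightarrow> v"
    by (rule uniform_limit_bcontfunE) auto
  have pw: "(\<lambda>n. F (k n) t) \<longlonglongrightarrow> v t" for t
    using tendsto_uniform_limitI[OF unif, of t] v by simp
  have "v \<in> ?C"
  proof (safe)
    fix s t
    show "c \<le> v t" by (rule Lim_bounded2[OF pw]) (use F in auto)
    show "v t \<le> B" by (rule Lim_bounded[OF pw]) (use F in auto)
    have "(\<lambda>n. F (k n) t) = (\<lambda>n. F (k n) (max a (min b t)))" using F by auto
    then show "v t = v (max a (min b t))" using pw[of t] pw[of "max a (min b t)"] LIMSEQ_unique by metis
    show "\<bar>v s - v t\<bar> \<le> L * \<bar>s - t\<bar>"
      by (rule Lim_bounded[OF tendsto_rabs[OF tendsto_diff[OF pw pw]]]) (use F in auto)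
  qed
  then show "\<exists>l\<in>?C. \<exists>r. strict_mono r \<and> (F \<circ> r) \<longlonglongrightarrow> l"
    using v(2) k by (auto simp: o_def)
qed

section \<open>The nonlinearity and its floor\<close>

locale mean_curvature_problem =
  fixes N :: nat and R \<delta> \<alpha> :: real and f :: "real \<Rightarrow> real \<Rightarrow> real"
  assumes N2: "N \<ge> 2" and R_pos: "0 < R" and \<delta>_nonneg: "0 \<le> \<delta>" and \<delta>_less: "\<delta> < R" and \<alpha>_gt: "\<alpha> > R"
    and f_cont: "continuous_on ({\<delta>..R} \<times> {0..<\<alpha>}) (\<lambda>(r, s). f r s)"
    and f_nonneg: "\<forall>r\<in>{\<delta>..R}. \<forall>s\<in>{0..<\<alpha>}. f r s \<ge> 0"
    and f_pos: "\<forall>r\<in>{\<delta>..R}. \<forall>s\<in>{0<..<\<alpha>}. f r s > 0"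
    and f_superlinear: "\<forall>M. \<forall>\<^sub>F s in at_right 0. \<forall>r\<in>{\<delta>..R}. f r s / s > M"
begin

definition cl :: "real \<Rightarrow> real" where "cl r = max \<delta> (min R r)"

lemma cl_mem [simp]: "cl r \<in> {\<delta>..R}" using \<delta>_less by (auto simp: cl_def)

lemma cl_ge [simp]: "\<delta> \<le> cl r" and cl_le [simp]: "cl r \<le> R" using cl_mem[of r] by auto

lemma cl_id [simp]: "r \<in> {\<delta>..R} \<Longrightarrow> cl r = r" by (auto simp: cl_def)

lemma cl_lipschitz: "\<bar>cl r - cl s\<bar> \<le> \<bar>r - s\<bar>" by (auto simp: cl_def)

text \<open>Clipping both arguments makes \<open>f\<close> a bounded, uniformly continuous function on the whole plane. The
clipping is invisible for functions with \<open>0 \<le> u \<le> R - \<delta>\<close>, a bound that all solutions satisfy.\<close>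

definition F :: "real \<Rightarrow> real \<Rightarrow> real" where
  "F r s = f (cl r) (max 0 (min (R - \<delta>) s))"

lemma clip_mem: "max 0 (min (R - \<delta>) s) \<in> {0..R - \<delta>}" "max 0 (min (R - \<delta>) s) \<in> {0..<\<alpha>}"
  using \<delta>_less \<delta>_nonneg \<alpha>_gt R_pos by auto

lemma F_eq: "r \<in> {\<delta>..R} \<Longrightarrow> 0 \<le> s \<Longrightarrow> s \<le> R - \<delta> \<Longrightarrow> F r s = f r s"
  by (simp add: F_def max_def min_def)

lemma F_nonneg: "0 \<le> F r s"
  using f_nonneg clip_mem cl_mem unfolding F_def by blast

lemma F_pos: "0 < s \<Longrightarrow> 0 < F r s"
  using f_pos cl_mem[of r] clip_mem[of s] \<delta>_less unfolding F_def by (auto simp: max_def)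

lemma continuous_on_box: "continuous_on ({\<delta>..R} \<times> {0..R - \<delta>}) (\<lambda>z. f (fst z) (snd z))"
  by (rule continuous_on_subset[OF f_cont[unfolded case_prod_unfold]]) (use \<delta>_less \<delta>_nonneg \<alpha>_gt in auto)

lemma compact_box: "compact ({\<delta>..R} \<times> {0..R - \<delta>})"
  by (intro compact_Times compact_Icc)

lemma F_cont: 
  assumes "continuous_on S a" "continuous_on S b"
  shows "continuous_on S (\<lambda>x. F (a x) (b x))"
  unfolding F_def cl_def
  by (rule continuous_on_compose2[OF continuous_on_box, of _ "\<lambda>x. (max \<delta> (min R (a x)), max 0 (min (R - \<delta>) (b x)))", simplified])
    (use \<delta>_less in \<open>auto intro!: continuous_intros assms\<close>)

lemma F_bounded: "\<exists>B. \<forall>r s. F r s \<le> B"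
proof -
  have ne: "{\<delta>..R} \<times> {0..R - \<delta>} \<noteq> {}" using \<delta>_less by auto
  obtain z where "\<forall>y\<in>{\<delta>..R} \<times> {0..R - \<delta>}. f (fst y) (snd y) \<le> f (fst z) (snd z)"
    using continuous_attains_sup[OF compact_box ne continuous_on_box] by blast
  then have "F r s \<le> f (fst z) (snd z)" for r s
    using cl_mem[of r] clip_mem(1)[of s] unfolding F_def
    by (metis SigmaI fst_conv snd_conv)
  then show ?thesis by blast
qed

definition F_max :: real where "F_max = (SOME B. \<forall>r s. F r s \<le> B)"

lemma F_le: "F r s \<le> F_max" using someI_ex[OF F_bounded] unfolding F_max_def by blast

lemma F_abs_le: "\<bar>F r s\<bar> \<le> F_max" using F_le F_nonneg by simp

lemma F_max_nonneg: "0 \<le> F_max" using F_le[of 0 0] F_nonneg[of 0 0] by simp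

lemma F_equicontinuous:
  assumes "0 < e"
  obtains d where "0 < d" "\<And>r s s'. \<bar>s - s'\<bar> < d \<Longrightarrow> \<bar>F r s - F r s'\<bar> < e"
proof -
  have "uniformly_continuous_on ({\<delta>..R} \<times> {0..R - \<delta>}) (\<lambda>z. f (fst z) (snd z))"
    by (rule compact_uniformly_continuous[OF continuous_on_box compact_box])
  then obtain d where d: "0 < d" and D: "\<And>x x'. x \<in> {\<delta>..R} \<times> {0..R - \<delta>} \<Longrightarrow> x' \<in> {\<delta>..R} \<times> {0..R - \<delta>} \<Longrightarrow>
      dist x' x < d \<Longrightarrow> dist (f (fst x') (snd x')) (f (fst x) (snd x)) < e"
    unfolding uniformly_continuous_on_def using assms by meson
  show thesis
  proof (rule that[OF d])
    fix r s s' :: real assume s: "\<bar>s - s'\<bar> < d"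
    let ?c = "\<lambda>s. max 0 (min (R - \<delta>) s)"
    have "\<bar>?c s - ?c s'\<bar> \<le> \<bar>s - s'\<bar>" by auto
    moreover have "dist (cl r, a) (cl r, b) = \<bar>a - b\<bar>" for a b :: real by (simp add: dist_Pair_Pair dist_real_def)
    ultimately have "dist (cl r, ?c s) (cl r, ?c s') < d" using s by (simp only: le_less_trans)
    then show "\<bar>F r s - F r s'\<bar> < e"
      using D[of "(cl r, ?c s')" "(cl r, ?c s)"] cl_mem[of r] clip_mem(1)[of s] clip_mem(1)[of s']
      unfolding F_def dist_real_def fst_conv snd_conv by blast
  qed
qed

text \<open>The floor will be used on \<open>[\<delta>, m]\<close>, where \<open>m = \<delta> + h\<close> is the midpoint. The constant \<open>c0\<close> is such that
\<open>l * f \<ge> c0 * e\<close> on \<open>[\<delta>, m]\<close> makes the radial average of \<open>l * f\<close> at least \<open>2 * e\<close> on \<open>[m, R]\<close>.\<close>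

definition h :: real where "h = (R - \<delta>) / 2"
definition m :: real where "m = (\<delta> + R) / 2"
definition J :: real where "J = integral {\<delta>..m} (\<lambda>s. s ^ (N - 1))"
definition c0 :: real where "c0 = 2 * R ^ (N - 1) / J"

lemma h_pos: "0 < h" and m_between: "\<delta> < m" "m < R" and R_minus_m: "R - m = h"
  using \<delta>_less by (auto simp: h_def m_def field_simps)

lemma J_pos: "0 < J" unfolding J_def using \<delta>_nonneg m_between by (intro radial_integral_pos)

lemma c0_pos: "0 < c0" using J_pos R_pos by (simp add: c0_def)

text \<open>This ensures that, at the parameter \<open>l\<close>, a function with values in \<open>[e * h, R - \<delta>]\<close> on \<open>[\<delta>, m]\<close> is sent to
one whose slope is at least \<open>e\<close> on \<open>[m, R]\<close>. Using \<open>min e (y / h)\<close>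
makes the condition hereditary in \<open>e\<close>.\<close>

definition admissible :: "real \<Rightarrow> real \<Rightarrow> bool" where
  "admissible l e \<longleftrightarrow> e \<le> 1/2 \<and> (\<forall>s. \<forall>y\<in>{0..R - \<delta>}. c0 * min e (y / h) \<le> l * F s y)"

lemma admissible_mono: "admissible l e \<Longrightarrow> l \<le> l' \<Longrightarrow> e' \<le> e \<Longrightarrow> admissible l' e'"
  unfolding admissible_def
proof (intro conjI ballI allI)
  fix s y
  assume a: "e \<le> 1/2 \<and> (\<forall>s. \<forall>y\<in>{0..R - \<delta>}. c0 * min e (y / h) \<le> l * F s y)" "l \<le> l'" "e' \<le> e" "y \<in> {0..R - \<delta>}"
  have "c0 * min e' (y / h) \<le> c0 * min e (y / h)" using c0_pos a by (intro mult_left_mono) auto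
  also have "\<dots> \<le> l * F s y" using a by auto
  also have "\<dots> \<le> l' * F s y" using a F_nonneg by (intro mult_right_mono) auto
  finally show "c0 * min e' (y / h) \<le> l' * F s y" .
qed auto

lemma admissible_zero: "0 \<le> l \<Longrightarrow> admissible l 0"
  unfolding admissible_def using h_pos F_nonneg by (auto simp: min_def)

text \<open>For small \<open>y\<close> the superlinearity of \<open>f\<close> at \<open>0\<close> beats the linear function \<open>c0 * (y / h)\<close>; for the other
\<open>y\<close> the positive minimum of \<open>f\<close> on a compact rectangle beats \<open>c0 * e\<close>, once \<open>e\<close> is small.\<close>

lemma admissible_exists:
  assumes l: "0 < l"
  shows "\<exists>e>0. admissible l e"
proof -
  have "\<forall>\<^sub>F s in at_right 0. \<forall>r\<in>{\<delta>..R}. f r s / s > c0 / (h * l)" using f_superlinear by blast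
  then obtain b where b: "0 < b" and small: "\<And>s r. 0 < s \<Longrightarrow> s < b \<Longrightarrow> r \<in> {\<delta>..R} \<Longrightarrow> f r s / s > c0 / (h * l)"
    unfolding eventually_at_right_field by auto
  define b' where "b' = min b (R - \<delta>)"
  have b': "0 < b'" "b' \<le> b" "b' \<le> R - \<delta>" using b \<delta>_less by (auto simp: b'_def)
  have box: "compact ({\<delta>..R} \<times> {b'..R - \<delta>})" "{\<delta>..R} \<times> {b'..R - \<delta>} \<noteq> {}"
    using b' \<delta>_less by (auto intro: compact_Times)
  have "continuous_on ({\<delta>..R} \<times> {b'..R - \<delta>}) (\<lambda>z. f (fst z) (snd z))"
    using continuous_on_box by (rule continuous_on_subset) (use b' in auto)
  then obtain z where z: "z \<in> {\<delta>..R} \<times> {b'..R - \<delta>}"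
    and zmin: "\<forall>y\<in>{\<delta>..R} \<times> {b'..R - \<delta>}. f (fst z) (snd z) \<le> f (fst y) (snd y)"
    using continuous_attains_inf[OF box] by blast
  define g0 where "g0 = f (fst z) (snd z)"
  have g0: "0 < g0" unfolding g0_def
    using z b' f_pos \<alpha>_gt \<delta>_nonneg by (intro f_pos[rule_format]) auto
  define e where "e = min (1/2) (l * g0 / c0)"
  have "0 < e" using g0 l c0_pos by (simp add: e_def)
  moreover have "c0 * min e (y / h) \<le> l * F s y" if y: "y \<in> {0..R - \<delta>}" for s y
  proof -
    have clip: "max 0 (min (R - \<delta>) y) = y" using y by auto
    consider "y = 0" | "0 < y" "y < b'" | "b' \<le> y" using y by fastforce
    then show ?thesis
    proof cases
      case 1 then show ?thesis using \<open>0 < e\<close> F_nonneg l by simp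
    next
      case 2
      then have "f (cl s) y / y > c0 / (h * l)" using small b' by auto
      then have "c0 * (y / h) < l * f (cl s) y" using 2 h_pos l by (simp add: field_simps)
      moreover have "c0 * min e (y / h) \<le> c0 * (y / h)" using c0_pos by (intro mult_left_mono) auto
      moreover have "F s y = f (cl s) y" using clip by (simp add: F_def)
      ultimately show ?thesis by simp
    next
      case 3
      have "c0 * min e (y / h) \<le> c0 * (l * g0 / c0)" using c0_pos by (intro mult_left_mono) (auto simp: e_def)
      also have "\<dots> = l * g0" using c0_pos by simp
      also have "\<dots> \<le> l * f (cl s) y" using zmin[rule_format, of "(cl s, y)"] 3 y l
        by (intro mult_left_mono) (auto simp: g0_def)
      also have "f (cl s) y = F s y" using clip by (simp add: F_def)
      finally show ?thesis .
    qed
  qed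
  moreover have "e \<le> 1/2" unfolding e_def by (rule min.cobounded1)
  ultimately show ?thesis unfolding admissible_def by blast
qed

definition inadmissible :: "(real \<times> real) set" where
  "inadmissible = {(l, e). 0 \<le> l \<and> 0 \<le> e \<and> \<not> admissible l e}"

text \<open>The largest admissible amplitude need not depend continuously on \<open>l\<close>. The distance of \<open>(l, 0)\<close> from
the inadmissible pairs does, and half of it is still admissible.\<close>

definition \<eta> :: "real \<Rightarrow> real" where "\<eta> l = infdist (l, 0) inadmissible / 2"

lemma \<eta>_nonneg: "0 \<le> \<eta> l" by (simp add: \<eta>_def infdist_nonneg)

lemma \<eta>_cont: "continuous_on S \<eta>"
  unfolding \<eta>_def by (intro continuous_intros) auto

lemma \<eta>_ok: assumes "0 \<le> l" shows "admissible l (\<eta> l)"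
proof (rule ccontr)
  assume "\<not> admissible l (\<eta> l)"
  then have "(l, \<eta> l) \<in> inadmissible" using assms \<eta>_nonneg by (simp add: inadmissible_def)
  then have "infdist (l, 0) inadmissible \<le> dist (l, 0) (l, \<eta> l)" by (rule infdist_le)
  also have "\<dots> = \<eta> l" using \<eta>_nonneg by (simp add: dist_Pair_Pair dist_real_def)
  finally have "\<eta> l = 0" using \<eta>_nonneg[of l] by (simp add: \<eta>_def)
  then show False using admissible_zero[OF assms] \<open>\<not> admissible l (\<eta> l)\<close> by simp
qed

text \<open>Admissibility of \<open>e\<close> at \<open>l0 / 2\<close> makes the quadrant \<open>{l0 / 2..} \<times> {..e}\<close> free of inadmissible pairs.\<close>

lemma \<eta>_lower:
  assumes "0 < l0"
  shows "\<exists>c>0. \<forall>l\<ge>l0. c \<le> \<eta> l"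
proof -
  obtain e where e: "0 < e" "admissible (l0 / 2) e" using admissible_exists[of "l0 / 2"] assms by auto
  have ne: "inadmissible \<noteq> {}" by (auto simp: inadmissible_def admissible_def intro!: exI[of _ 0] exI[of _ 1])
  have "min (l0 / 2) e \<le> infdist (l, 0) inadmissible" if "l0 \<le> l" for l
    unfolding infdist_notempty[OF ne]
  proof (rule cINF_greatest[OF ne])
    fix x assume "x \<in> inadmissible"
    then obtain \<mu> k where x: "x = (\<mu>, k)" "0 \<le> k" "\<not> admissible \<mu> k" by (auto simp: inadmissible_def)
    then have "\<mu> < l0 / 2 \<or> e < k" using admissible_mono[OF e(2), of \<mu> k] by force
    then have "min (l0 / 2) e \<le> \<bar>l - \<mu>\<bar> \<or> min (l0 / 2) e \<le> \<bar>k\<bar>" using that by auto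
    moreover have "\<bar>l - \<mu>\<bar> \<le> dist (l, 0) x" "\<bar>k\<bar> \<le> dist (l, 0) x"
      using dist_fst_le[of "(l, 0)" x] dist_snd_le[of "(l, 0)" x] x by (auto simp: dist_real_def)
    ultimately show "min (l0 / 2) e \<le> dist (l, 0) x" by linarith
  qed
  then show ?thesis using e(1) assms
    by (intro exI[of _ "min (l0 / 2) e / 2"]) (auto simp: \<eta>_def)
qed

lemma \<eta>_pos: "0 < l \<Longrightarrow> 0 < \<eta> l"
  using \<eta>_lower[of l] by (meson less_le_trans order_refl)

lemma \<eta>_le: "0 \<le> l \<Longrightarrow> \<eta> l \<le> 1/2" using \<eta>_ok by (simp add: admissible_def)

text \<open>A tent with a flat top on \<open>[\<delta>, m]\<close>: slopes vanish at \<open>\<delta>\<close>, so they can be bounded below only away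
from \<open>\<delta>\<close>.\<close>

definition \<psi> :: "real \<Rightarrow> real" where "\<psi> r = min (R - r) h"

lemma \<psi>_nonneg: "r \<le> R \<Longrightarrow> 0 \<le> \<psi> r" using h_pos by (simp add: \<psi>_def)

section \<open>The fixed-point equation for the negative slope\<close>

text \<open>The function that vanishes at \<open>R\<close> and has derivative \<open>-v\<close>.\<close>

definition U :: "(real \<Rightarrow> real) \<Rightarrow> real \<Rightarrow> real" where "U v r = integral {r..R} v"

lemma continuous_on_tail:
  fixes v :: "real \<Rightarrow> real"
  shows "continuous_on {\<delta>..R} v \<Longrightarrow> \<delta> \<le> r \<Longrightarrow> continuous_on {r..R} v"
  by (erule continuous_on_subset) auto

lemma U_vector_derivative:
  assumes "continuous_on {\<delta>..R} v" "r \<in> {\<delta>..R}"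
  shows "(U v has_vector_derivative - v r) (at r within {\<delta>..R})"
proof -
  have "((\<lambda>r. integral {\<delta>..R} v - integral {\<delta>..r} v) has_vector_derivative 0 - v r) (at r within {\<delta>..R})"
    by (intro has_vector_derivative_diff has_vector_derivative_const integral_has_vector_derivative assms)
  then have d: "((\<lambda>r. integral {\<delta>..R} v - integral {\<delta>..r} v) has_vector_derivative - v r) (at r within {\<delta>..R})"
    by simp
  have eq: "U v x = integral {\<delta>..R} v - integral {\<delta>..x} v" if "x \<in> {\<delta>..R}" for x
    using Henstock_Kurzweil_Integration.integral_combine[OF _ _ integrable_continuous_interval[OF assms(1)], of x] that
    by (simp add: U_def)
  show ?thesis by (rule has_vector_derivative_transform[OF assms(2) eq d])
qed

lemma U_cont: assumes "continuous_on {\<delta>..R} v" shows "continuous_on {\<delta>..R} (U v)"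
  unfolding continuous_on_eq_continuous_within
  by (intro ballI has_vector_derivative_continuous[OF U_vector_derivative[OF assms]])

lemma U_R [simp]: "U v R = 0" by (simp add: U_def)

lemma U_mono:
  assumes "continuous_on {\<delta>..R} v" "continuous_on {\<delta>..R} w" "r \<in> {\<delta>..R}" "\<And>t. t \<in> {r..R} \<Longrightarrow> v t \<le> w t"
  shows "U v r \<le> U w r"
proof -
  have "continuous_on {r..R} v" "continuous_on {r..R} w"
    using assms by (auto intro!: continuous_on_tail)
  then show ?thesis unfolding U_def using assms by (intro integral_le integrable_continuous_interval) auto
qed

lemma U_bounds:
  assumes "continuous_on {\<delta>..R} v" "r \<in> {\<delta>..R}" "\<And>t. t \<in> {r..R} \<Longrightarrow> c \<le> v t" "\<And>t. t \<in> {r..R} \<Longrightarrow> v t \<le> C"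
  shows "c * (R - r) \<le> U v r" "U v r \<le> C * (R - r)"
  using U_mono[of "\<lambda>_. c" v r] U_mono[of v "\<lambda>_. C" r] assms by (auto simp: U_def mult.commute)

lemma U_diff:
  assumes "continuous_on {\<delta>..R} v" "continuous_on {\<delta>..R} w" "r \<in> {\<delta>..R}"
  shows "U v r - U w r = U (\<lambda>t. v t - w t) r"
proof -
  have "continuous_on {r..R} v" "continuous_on {r..R} w"
    using assms by (auto intro!: continuous_on_tail)
  then show ?thesis unfolding U_def by (intro integral_diff[symmetric] integrable_continuous_interval)
qed

lemma U_decreasing:
  assumes "continuous_on {\<delta>..R} v" "\<delta> \<le> r" "r \<le> s" "s \<le> R" "\<And>t. t \<in> {\<delta>..R} \<Longrightarrow> 0 \<le> v t"
  shows "U v s \<le> U v r"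
proof -
  have "continuous_on {r..R} v" "continuous_on {s..R} v" using assms by (auto intro!: continuous_on_tail)
  then show ?thesis unfolding U_def using assms
    by (intro integral_subset_le integrable_continuous_interval) auto
qed

lemma U_ge_floor:
  assumes v: "continuous_on {\<delta>..R} v" and nonneg: "\<And>t. t \<in> {\<delta>..R} \<Longrightarrow> 0 \<le> v t"
    and e: "\<And>t. t \<in> {m..R} \<Longrightarrow> e \<le> v t" and r: "r \<in> {\<delta>..R}" and e0: "0 \<le> e"
  shows "e * \<psi> r \<le> U v r"
proof (cases "m \<le> r")
  case True
  have "e * \<psi> r \<le> e * (R - r)" using e0 by (intro mult_left_mono) (auto simp: \<psi>_def)
  also have "\<dots> \<le> U v r" using U_mono[of "\<lambda>_. e" v r] v e r True by (auto simp: U_def mult.commute)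
  finally show ?thesis .
next
  case False
  have "e * \<psi> r \<le> e * (R - m)" using e0 by (intro mult_left_mono) (auto simp: \<psi>_def R_minus_m)
  also have "\<dots> \<le> U v m" using U_mono[of "\<lambda>_. e" v m] v e m_between by (auto simp: U_def mult.commute)
  also have "\<dots> \<le> U v r" using U_decreasing[OF v, of r m] False r m_between nonneg by auto
  finally show ?thesis .
qed

definition G :: "real \<Rightarrow> (real \<Rightarrow> real) \<Rightarrow> real \<Rightarrow> real" where
  "G l v s = F s (max (U v s) (\<eta> l * \<psi> s))"

lemma G_cont: "continuous_on {\<delta>..R} v \<Longrightarrow> continuous_on {\<delta>..R} (G l v)"
  unfolding G_def \<psi>_def by (intro F_cont continuous_intros U_cont)

lemma continuous_on_init: 
  fixes v :: "real \<Rightarrow> real"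
  shows "continuous_on {\<delta>..R} v \<Longrightarrow> t \<le> R \<Longrightarrow> continuous_on {\<delta>..t} v"
  by (erule continuous_on_subset) auto

definition slope :: "real \<Rightarrow> (real \<Rightarrow> real) \<Rightarrow> real \<Rightarrow> real" where
  "slope l v t = phi1_inv (l * radial_avg N \<delta> (G l v) (cl t))"

lemma slope_nonneg:
  assumes "0 \<le> l" "continuous_on {\<delta>..R} v"
  shows "0 \<le> slope l v t"
  unfolding slope_def
  by (intro phi1_inv_nonneg mult_nonneg_nonneg assms radial_avg_nonneg \<delta>_nonneg cl_ge
      continuous_on_init[OF G_cont[OF assms(2)] cl_le]) (simp add: G_def F_nonneg)

lemma slope_less_1: "slope l v t < 1"
  using phi1_inv_abs_less unfolding slope_def by (simp add: abs_less_iff)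

lemma slope_cl [simp]: "slope l v (cl t) = slope l v t" by (simp add: slope_def)

lemma slope_lipschitz:
  assumes "0 \<le> l" "continuous_on {\<delta>..R} v"
  shows "\<bar>slope l v s - slope l v t\<bar> \<le> l * (real N * F_max) * \<bar>s - t\<bar>"
proof -
  have *: "\<bar>radial_avg N \<delta> (G l v) (cl t) - radial_avg N \<delta> (G l v) (cl s)\<bar> \<le> real N * F_max * (cl t - cl s)"
    if "cl s \<le> cl t" for s t
    using that N2 F_abs_le
    by (intro radial_avg_lipschitz \<delta>_nonneg continuous_on_init[OF G_cont[OF assms(2)]]) (auto simp: G_def)
  have "\<bar>radial_avg N \<delta> (G l v) (cl s) - radial_avg N \<delta> (G l v) (cl t)\<bar> \<le> real N * F_max * \<bar>cl s - cl t\<bar>"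
    using *[of s t] *[of t s] by (cases "cl s \<le> cl t") (auto simp: abs_minus_commute)
  also have "\<dots> \<le> real N * F_max * \<bar>s - t\<bar>"
    using cl_lipschitz F_max_nonneg by (intro mult_left_mono mult_nonneg_nonneg) auto
  finally have "l * \<bar>radial_avg N \<delta> (G l v) (cl s) - radial_avg N \<delta> (G l v) (cl t)\<bar> \<le> l * (real N * F_max * \<bar>s - t\<bar>)"
    using assms(1) by (intro mult_left_mono) auto
  moreover have "\<bar>slope l v s - slope l v t\<bar> \<le> \<bar>l * radial_avg N \<delta> (G l v) (cl s) - l * radial_avg N \<delta> (G l v) (cl t)\<bar>"
    unfolding slope_def by (rule phi1_inv_lipschitz)
  ultimately show ?thesis using assms(1)
    by (simp add: abs_mult right_diff_distrib[symmetric] mult_ac)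
qed

lemma slope_cont:
  assumes "0 \<le> l" "continuous_on {\<delta>..R} v"
  shows "continuous_on S (slope l v)"
proof -
  have "continuous_on UNIV (slope l v)"
  proof (rule lipschitz_on_continuous_on)
    show "(l * (real N * F_max))-lipschitz_on UNIV (slope l v)"
      using slope_lipschitz[OF assms] assms(1) F_max_nonneg by (intro lipschitz_onI) (auto simp: dist_real_def)
  qed
  then show ?thesis using continuous_on_subset by blast
qed

definition V :: "real \<Rightarrow> (real \<Rightarrow>\<^sub>C real) \<Rightarrow> (real \<Rightarrow>\<^sub>C real)" where
  "V l v = Bcontfun (slope l v)"

lemma apply_V:
  assumes "0 \<le> l"
  shows "apply_bcontfun (V l v) = slope l v"
  unfolding V_def
proof (intro Bcontfun_inverse bcontfun_normI)
  show "norm (slope l v t) \<le> 1" for t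
    using slope_nonneg[OF assms, of v t] slope_less_1[of l v t] by simp
qed (rule slope_cont[OF assms]; simp)

text \<open>Extending functions on \<open>[\<delta>, R]\<close> by constants to the real line places them in the Banach space of
bounded continuous functions.\<close>

definition C :: "real \<Rightarrow> (real \<Rightarrow>\<^sub>C real) set" where
  "C L = {v :: real \<Rightarrow>\<^sub>C real. (\<forall>t. 0 \<le> v t \<and> v t \<le> 1) \<and> (\<forall>t. v t = v (cl t)) \<and> (\<forall>s t. \<bar>v s - v t\<bar> \<le> L * \<bar>s - t\<bar>)}"

lemma compact_C: "compact (C L)"
  unfolding C_def cl_def using \<delta>_less by (intro compact_lipschitz_bcontfun) auto

lemma convex_C: "convex (C L)"
proof (rule convexI)
  fix x y :: "real \<Rightarrow>\<^sub>C real" and u v :: real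
  assume xy: "x \<in> C L" "y \<in> C L" and uv: "0 \<le> u" "0 \<le> v" "u + v = 1"
  show "u *\<^sub>R x + v *\<^sub>R y \<in> C L"
    unfolding C_def
  proof (intro CollectI conjI allI)
    fix s t :: real
    have xt: "0 \<le> x t" "x t \<le> 1" "0 \<le> y t" "y t \<le> 1" "\<bar>x s - x t\<bar> \<le> L * \<bar>s - t\<bar>" "\<bar>y s - y t\<bar> \<le> L * \<bar>s - t\<bar>"
      and cl: "x t = x (cl t)" "y t = y (cl t)"
      using xy unfolding C_def by blast+
    show "0 \<le> (u *\<^sub>R x + v *\<^sub>R y) t" using xt uv by simp
    have "u * x t + v * y t \<le> u * 1 + v * 1" using xt uv by (intro add_mono mult_left_mono) auto
    then show "(u *\<^sub>R x + v *\<^sub>R y) t \<le> 1" using uv by simp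
    show "(u *\<^sub>R x + v *\<^sub>R y) t = (u *\<^sub>R x + v *\<^sub>R y) (cl t)" using cl by simp
    have "(u *\<^sub>R x + v *\<^sub>R y) s - (u *\<^sub>R x + v *\<^sub>R y) t = u * (x s - x t) + v * (y s - y t)"
      by (simp add: algebra_simps)
    also have "\<bar>\<dots>\<bar> \<le> u * \<bar>x s - x t\<bar> + v * \<bar>y s - y t\<bar>"
      using abs_triangle_ineq[of "u * (x s - x t)" "v * (y s - y t)"] uv by (simp add: abs_mult)
    also have "\<dots> \<le> u * (L * \<bar>s - t\<bar>) + v * (L * \<bar>s - t\<bar>)" using xt uv by (intro add_mono mult_left_mono)
    also have "\<dots> = L * \<bar>s - t\<bar>" using uv by (simp flip: distrib_right)
    finally show "\<bar>(u *\<^sub>R x + v *\<^sub>R y) s - (u *\<^sub>R x + v *\<^sub>R y) t\<bar> \<le> L * \<bar>s - t\<bar>" .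
  qed
qed

lemma zero_in_C: "0 \<le> L \<Longrightarrow> 0 \<in> C L" by (simp add: C_def)

lemma V_in_C:
  assumes "0 \<le> l" "l \<le> b"
  shows "V l v \<in> C (b * (real N * F_max))"
proof -
  have "\<bar>V l v s - V l v t\<bar> \<le> b * (real N * F_max) * \<bar>s - t\<bar>" for s t
  proof -
    have "\<bar>V l v s - V l v t\<bar> \<le> l * (real N * F_max) * \<bar>s - t\<bar>"
      unfolding apply_V[OF assms(1)] using assms(1) by (intro slope_lipschitz) auto
    also have "\<dots> \<le> b * (real N * F_max) * \<bar>s - t\<bar>"
      using assms F_max_nonneg by (intro mult_right_mono mult_nonneg_nonneg) auto
    finally show ?thesis .
  qed
  then show ?thesis unfolding C_def
    using apply_V[OF assms(1), of v] slope_nonneg[OF assms(1), of v] slope_less_1[of l v] by (auto simp: less_imp_le)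
qed

lemma U_dist:
  fixes v w :: "real \<Rightarrow>\<^sub>C real"
  assumes "r \<in> {\<delta>..R}"
  shows "\<bar>U v r - U w r\<bar> \<le> (R - \<delta>) * dist v w"
proof -
  have d: "\<bar>v t - w t\<bar> \<le> dist v w" for t using dist_bounded[of v t w] by (simp add: dist_real_def)
  then have d': "v t - w t \<le> dist v w" "- dist v w \<le> v t - w t" for t
    using d[of t] by linarith+
  have "- dist v w * (R - r) \<le> U (\<lambda>t. v t - w t) r" "U (\<lambda>t. v t - w t) r \<le> dist v w * (R - r)"
    using d' assms by (intro U_bounds[where c = "- dist v w" and C = "dist v w"] continuous_intros; simp)+
  moreover have "dist v w * (R - r) \<le> dist v w * (R - \<delta>)" using assms by (intro mult_left_mono) auto
  ultimately show ?thesis using U_diff[of v w r] assms by (simp add: abs_le_iff mult.commute)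
qed

text \<open>The map \<open>\<phi>\<^sub>1\<^sup>-\<^sup>1\<close> is 1-Lipschitz and the radial average is linear and bounded, so all that matters is the
distance of the integrands.\<close>

lemma V_dist:
  fixes v w :: "real \<Rightarrow>\<^sub>C real"
  assumes l: "0 \<le> l" "0 \<le> k" and c: "\<And>s. s \<in> {\<delta>..R} \<Longrightarrow> \<bar>G l v s - G k w s\<bar> \<le> c"
  shows "dist (V l v) (V k w) \<le> (\<bar>l - k\<bar> * F_max + k * c) * (R - \<delta>)"
proof (rule dist_bound)
  fix t
  have gc: "continuous_on {\<delta>..cl t} (G l v)" "continuous_on {\<delta>..cl t} (G k w)"
    by (rule continuous_on_init[OF G_cont cl_le]; simp)+
  have b: "\<bar>l * G l v s - k * G k w s\<bar> \<le> \<bar>l - k\<bar> * F_max + k * c" if "s \<in> {\<delta>..cl t}" for s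
  proof -
    have s: "s \<in> {\<delta>..R}" using that cl_le[of t] by (auto intro: order_trans)
    have Gb: "\<bar>G l v s\<bar> \<le> F_max" unfolding G_def by (rule F_abs_le)
    have eq: "l * G l v s - k * G k w s = (l - k) * G l v s + k * (G l v s - G k w s)" by (simp add: algebra_simps)
    have "\<bar>l * G l v s - k * G k w s\<bar> \<le> \<bar>l - k\<bar> * \<bar>G l v s\<bar> + k * \<bar>G l v s - G k w s\<bar>"
      unfolding eq using abs_triangle_ineq[of "(l - k) * G l v s" "k * (G l v s - G k w s)"] l by (simp add: abs_mult)
    also have "\<dots> \<le> \<bar>l - k\<bar> * F_max + k * c"
      by (rule add_mono[OF mult_left_mono[OF Gb abs_ge_zero] mult_left_mono[OF c[OF s] l(2)]])
    finally show ?thesis .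
  qed
  have "dist (V l v t) (V k w t) \<le> \<bar>l * radial_avg N \<delta> (G l v) (cl t) - k * radial_avg N \<delta> (G k w) (cl t)\<bar>"
    unfolding apply_V[OF l(1)] apply_V[OF l(2)] slope_def dist_real_def by (rule phi1_inv_lipschitz)
  also have "\<dots> = \<bar>radial_avg N \<delta> (\<lambda>s. l * G l v s - k * G k w s) (cl t)\<bar>"
    unfolding radial_avg_cmult by (subst radial_avg_diff) (auto intro!: continuous_intros gc)
  also have "\<dots> \<le> (\<bar>l - k\<bar> * F_max + k * c) * (cl t - \<delta>)"
    by (intro radial_avg_bound \<delta>_nonneg cl_ge continuous_intros gc b)
  also have "\<dots> \<le> (\<bar>l - k\<bar> * F_max + k * c) * (R - \<delta>)"
  proof (intro mult_left_mono)
    show "0 \<le> \<bar>l - k\<bar> * F_max + k * c" using order_trans[OF abs_ge_zero b[of \<delta>]] by simp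
  qed simp
  finally show "dist (V l v t) (V k w t) \<le> (\<bar>l - k\<bar> * F_max + k * c) * (R - \<delta>)" .
qed

text \<open>The integrands are uniformly close because \<open>F\<close> is uniformly continuous in its second argument and
\<open>\<eta>\<close> is continuous.\<close>

lemma V_cont: "continuous_on ({0..} \<times> UNIV) (\<lambda>(l, v). V l v)"
  unfolding continuous_on_def
proof (safe, rule tendstoI)
  fix k :: real and w :: "real \<Rightarrow>\<^sub>C real" and e :: real
  assume k: "0 \<le> k" and e: "0 < e"
  define F0 where "F0 = at (k, w) within {0..} \<times> (UNIV :: (real \<Rightarrow>\<^sub>C real) set)"
  define c where "c = e / (2 * (k + 1) * (R - \<delta>))"
  have Rd: "0 < R - \<delta>" using \<delta>_less by simp
  have c: "0 < c" using e k Rd by (simp add: c_def)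
  obtain d where d: "0 < d" and D: "\<And>r s s'. \<bar>s - s'\<bar> < d \<Longrightarrow> \<bar>F r s - F r s'\<bar> < c"
    using F_equicontinuous[OF c] by blast
  have id: "((\<lambda>z. z) \<longlongrightarrow> (k, w)) F0" unfolding F0_def by (rule tendsto_ident_at)
  note lim1 = tendsto_fst[OF id, simplified] and lim2 = tendsto_snd[OF id, simplified]
  have lim\<eta>: "((\<lambda>z. \<eta> (fst z)) \<longlongrightarrow> \<eta> k) F0"
    using \<eta>_cont[of UNIV] lim1 by (auto intro: continuous_on_tendsto_compose)
  have "((\<lambda>z. \<bar>fst z - k\<bar> * F_max * (R - \<delta>)) \<longlongrightarrow> \<bar>k - k\<bar> * F_max * (R - \<delta>)) F0"
    by (intro tendsto_intros lim1)
  then have ev1: "\<forall>\<^sub>F z in F0. \<bar>fst z - k\<bar> * F_max * (R - \<delta>) < e / 2"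
    using e by (intro order_tendstoD(2)) auto
  have "((\<lambda>z. (R - \<delta>) * dist (snd z) w + \<bar>\<eta> (fst z) - \<eta> k\<bar> * h) \<longlongrightarrow> (R - \<delta>) * dist w w + \<bar>\<eta> k - \<eta> k\<bar> * h) F0"
    by (intro tendsto_intros lim2 lim\<eta>)
  then have ev2: "\<forall>\<^sub>F z in F0. (R - \<delta>) * dist (snd z) w + \<bar>\<eta> (fst z) - \<eta> k\<bar> * h < d"
    using d by (intro order_tendstoD(2)) auto
  have ev3: "\<forall>\<^sub>F z in F0. 0 \<le> fst z"
    unfolding F0_def eventually_at_filter by (auto intro: always_eventually)
  have "\<forall>\<^sub>F z in F0. dist (V (fst z) (snd z)) (V k w) < e"
    using ev1 ev2 ev3
  proof eventually_elim
    case (elim z)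
    obtain l v where z: "z = (l, v)" by (cases z)
    have "\<bar>G l v s - G k w s\<bar> \<le> c" if s: "s \<in> {\<delta>..R}" for s
    proof -
      have "\<bar>\<eta> l * \<psi> s - \<eta> k * \<psi> s\<bar> = \<bar>\<eta> l - \<eta> k\<bar> * \<psi> s"
        using \<psi>_nonneg[of s] s by (simp add: abs_mult left_diff_distrib[symmetric])
      also have "\<dots> \<le> \<bar>\<eta> l - \<eta> k\<bar> * h" by (intro mult_left_mono) (auto simp: \<psi>_def)
      finally have 1: "\<bar>\<eta> l * \<psi> s - \<eta> k * \<psi> s\<bar> \<le> \<bar>\<eta> l - \<eta> k\<bar> * h" .
      have "\<bar>max a b - max a' b'\<bar> \<le> \<bar>a - a'\<bar> + \<bar>b - b'\<bar>" for a b a' b' :: real by (auto simp: max_def)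
      then have "\<bar>max (U v s) (\<eta> l * \<psi> s) - max (U w s) (\<eta> k * \<psi> s)\<bar> < d"
        using U_dist[OF s, of v w] 1 elim(2) z by (smt (verit) fst_conv snd_conv)
      then show ?thesis unfolding G_def by (intro less_imp_le D)
    qed
    then have "dist (V l v) (V k w) \<le> (\<bar>l - k\<bar> * F_max + k * c) * (R - \<delta>)"
      using elim(3) k z by (intro V_dist) auto
    also have "\<dots> = \<bar>l - k\<bar> * F_max * (R - \<delta>) + k * c * (R - \<delta>)" by (simp add: algebra_simps)
    also have "\<dots> < e / 2 + e / 2"
    proof (rule add_less_le_mono)
      show "\<bar>l - k\<bar> * F_max * (R - \<delta>) < e / 2" using elim(1) z by simp
      have "k * c * (R - \<delta>) \<le> (k + 1) * c * (R - \<delta>)" using c Rd by (intro mult_right_mono) auto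
      also have "\<dots> = e / 2" 
      proof -
        have "A * (e / (2 * A * B)) * B = e / 2" if "A \<noteq> 0" "B \<noteq> 0" for A B :: real using that by simp
        from this[of "k + 1" "R - \<delta>"] show ?thesis using k Rd by (simp add: c_def)
      qed
      finally show "k * c * (R - \<delta>) \<le> e / 2" .
    qed
    finally show ?case using z by simp
  qed
  then show "\<forall>\<^sub>F z in at (k, w) within {0..} \<times> UNIV. dist (case z of (l, v) \<Rightarrow> V l v) (V k w) < e"
    unfolding F0_def by (simp add: case_prod_unfold)
qed

text \<open>The fixed points of the modified problem. They will turn out to be the nontrivial solutions, with
\<open>v\<close> for \<open>-u'\<close>, together with \<open>(0, 0)\<close>.\<close>

definition K :: "(real \<times> (real \<Rightarrow>\<^sub>C real)) set" where
  "K = {(l, v). 0 \<le> l \<and> V l v = v}"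

lemma closed_K: "closed K"
proof -
  have "continuous_on ({0..} \<times> UNIV) (\<lambda>z. V (fst z) (snd z) - snd z)"
    using V_cont by (intro continuous_intros) (simp add: case_prod_unfold)
  then have "closed (({0..} \<times> UNIV) \<inter> (\<lambda>z. V (fst z) (snd z) - snd z) -` {0})"
    by (intro continuous_closed_preimage closed_Times) auto
  also have "({0..} \<times> UNIV) \<inter> (\<lambda>z. V (fst z) (snd z) - snd z) -` {0} = K"
    by (auto simp: K_def)
  finally show ?thesis .
qed

lemma V_zero: "V 0 v = 0"
  by (rule bcontfun_eqI) (simp add: apply_V slope_def)

lemma K_at_0: "(0, v) \<in> K \<longleftrightarrow> v = 0" by (auto simp: K_def V_zero)

lemma K_continuum:
  assumes b: "0 \<le> b"
  obtains S where "connected S" "S \<subseteq> K" "(0, 0) \<in> S" "\<exists>v. (b, v) \<in> S" "fst ` S \<subseteq> {0..b}"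
proof (rule continuum_of_fixed_points[OF b compact_C convex_C, of "b * (real N * F_max)" V 0])
  show "continuous_on ({0..b} \<times> C (b * (real N * F_max))) (\<lambda>(t, x). V t x)"
    by (rule continuous_on_subset[OF V_cont]) auto
  show "0 \<in> C (b * (real N * F_max))" using b F_max_nonneg by (intro zero_in_C) auto
  fix S assume "connected S" "S \<subseteq> {(t, x). t \<in> {0..b} \<and> x \<in> C (b * (real N * F_max)) \<and> V t x = x}" "(0, 0) \<in> S" "\<exists>x. (b, x) \<in> S"
  then show thesis by (intro that[of S]) (auto simp: K_def)
qed (auto simp: V_zero intro: V_in_C)

section \<open>Fixed points are the nontrivial solutions\<close>

lemma R_power_pos: "0 < R ^ n" using R_pos by simp

lemma radial_avg_ge:
  assumes t: "\<delta> < b" "b \<le> t" "t \<le> R" and g: "continuous_on {\<delta>..R} g"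
    and nonneg: "\<And>s. s \<in> {\<delta>..R} \<Longrightarrow> 0 \<le> g s" and c: "\<And>s. s \<in> {\<delta>..b} \<Longrightarrow> c \<le> g s" "0 \<le> c"
  shows "c * integral {\<delta>..b} (\<lambda>s. s ^ (N - 1)) / R ^ (N - 1) \<le> radial_avg N \<delta> g t"
proof -
  have tpos: "0 < t" using t \<delta>_nonneg by simp
  have "c * integral {\<delta>..b} (\<lambda>s. s ^ (N - 1)) \<le> integral {\<delta>..t} (\<lambda>s. s ^ (N - 1) * g s)"
    using t by (intro radial_integral_ge \<delta>_nonneg continuous_on_init[OF g] nonneg c) auto
  then have "c * integral {\<delta>..b} (\<lambda>s. s ^ (N - 1)) / t ^ (N - 1) \<le> radial_avg N \<delta> g t"
    unfolding radial_avg_def using tpos by (intro divide_right_mono) auto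
  moreover have "c * integral {\<delta>..b} (\<lambda>s. s ^ (N - 1)) / R ^ (N - 1) \<le> c * integral {\<delta>..b} (\<lambda>s. s ^ (N - 1)) / t ^ (N - 1)"
  proof (rule divide_left_mono)
    show "t ^ (N - 1) \<le> R ^ (N - 1)" using t tpos by (intro power_mono) auto
    show "0 \<le> c * integral {\<delta>..b} (\<lambda>s. s ^ (N - 1))"
      using radial_integral_pos[OF \<delta>_nonneg t(1), of "N - 1"] c(2) by simp
    show "0 < R ^ (N - 1) * t ^ (N - 1)" using R_pos tpos by simp
  qed
  ultimately show ?thesis by linarith
qed

lemma U_range:
  assumes "continuous_on {\<delta>..R} v" "\<And>t. t \<in> {\<delta>..R} \<Longrightarrow> 0 \<le> v t" "\<And>t. t \<in> {\<delta>..R} \<Longrightarrow> v t \<le> 1" "s \<in> {\<delta>..R}"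
  shows "0 \<le> U v s" "U v s \<le> R - \<delta>"
  using U_bounds[of v s 0 1] assms by auto

text \<open>On \<open>[\<delta>, m]\<close> the argument of \<open>F\<close> is at least \<open>\<eta> l * h\<close>, so admissibility bounds \<open>l * G l v\<close> below by
\<open>c0 * \<eta> l\<close> there. By the choice of \<open>c0\<close> its radial average is at least \<open>2 * \<eta> l\<close> beyond \<open>m\<close>.\<close>

lemma slope_floor:
  assumes l: "0 \<le> l" and v: "continuous_on {\<delta>..R} v"
    and v01: "\<And>t. t \<in> {\<delta>..R} \<Longrightarrow> 0 \<le> v t" "\<And>t. t \<in> {\<delta>..R} \<Longrightarrow> v t \<le> 1" and t: "t \<in> {m..R}"
  shows "\<eta> l \<le> slope l v t"
proof -
  have "c0 * \<eta> l \<le> l * G l v s" if s: "s \<in> {\<delta>..m}" for s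
  proof -
    have sR: "s \<in> {\<delta>..R}" using s m_between by auto
    have \<psi>s: "\<psi> s = h" using s R_minus_m by (auto simp: \<psi>_def)
    define y where "y = max (U v s) (\<eta> l * \<psi> s)"
    have "\<eta> l * h \<le> 1 * h" using \<eta>_le[OF l] h_pos by (intro mult_right_mono) auto
    moreover have "h \<le> R - \<delta>" using \<delta>_less by (simp add: h_def)
    ultimately have "\<eta> l * h \<le> R - \<delta>" by linarith
    then have y: "y \<in> {0..R - \<delta>}" using U_range[OF v v01 sR] by (auto simp: y_def \<psi>s)
    have "\<eta> l \<le> y / h" using h_pos by (simp add: y_def \<psi>s pos_le_divide_eq)
    then have "min (\<eta> l) (y / h) = \<eta> l" by simp
    moreover have "c0 * min (\<eta> l) (y / h) \<le> l * F s y" using \<eta>_ok[OF l] y unfolding admissible_def by blast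
    ultimately show ?thesis by (simp add: G_def y_def)
  qed
  then have "c0 * \<eta> l * J / R ^ (N - 1) \<le> radial_avg N \<delta> (\<lambda>s. l * G l v s) t"
    unfolding J_def using t m_between l c0_pos \<eta>_nonneg
    by (intro radial_avg_ge continuous_intros G_cont[OF v]) (auto simp: G_def F_nonneg)
  moreover have "c0 * \<eta> l * J / R ^ (N - 1) = 2 * \<eta> l"
    using J_pos R_pos by (simp add: c0_def)
  ultimately have "2 * \<eta> l \<le> l * radial_avg N \<delta> (G l v) (cl t)"
    using t m_between by (simp add: radial_avg_cmult)
  then have "phi1_inv (2 * \<eta> l) \<le> slope l v t" unfolding slope_def by (rule phi1_inv_mono)
  then show ?thesis using phi1_inv_double_ge(1)[OF \<eta>_nonneg \<eta>_le[OF l]] by linarith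
qed

lemma K_props:
  assumes "(l, v) \<in> K"
  shows "0 \<le> l" "v t = slope l v t" "0 \<le> v t" "v t < 1" "v (cl t) = v t"
proof -
  show l: "0 \<le> l" using assms by (simp add: K_def)
  have eq: "apply_bcontfun v = slope l v" using apply_V[OF l, of v] assms by (simp add: K_def)
  show "v t = slope l v t" "0 \<le> v t" "v t < 1" "v (cl t) = v t"
    using slope_nonneg[OF l, of v t] slope_less_1[of l v t] slope_cl[of l v t] by (simp_all add: eq[symmetric])
qed

text \<open>This makes the lifting in \<open>G\<close> invisible at a fixed point.\<close>

lemma K_floor:
  assumes "(l, v) \<in> K"
  shows "t \<in> {m..R} \<Longrightarrow> \<eta> l \<le> v t" "s \<in> {\<delta>..R} \<Longrightarrow> \<eta> l * \<psi> s \<le> U v s"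
proof -
  note K = K_props[OF assms]
  show *: "\<eta> l \<le> v t" if "t \<in> {m..R}" for t
  proof -
    have "\<eta> l \<le> slope l v t"
    proof (rule slope_floor[OF K(1) _ _ _ that])
      show "0 \<le> v t" "v t \<le> 1" for t using K(3,4)[of t] by auto
    qed simp
    then show ?thesis using K(2)[of t] by simp
  qed
  show "\<eta> l * \<psi> s \<le> U v s" if "s \<in> {\<delta>..R}"
    by (rule U_ge_floor[OF _ K(3) * that \<eta>_nonneg]) simp_all
qed

lemma K_U_range: "(l, v) \<in> K \<Longrightarrow> s \<in> {\<delta>..R} \<Longrightarrow> 0 \<le> U v s \<and> U v s \<le> R - \<delta>"
  by (intro conjI U_range) (use K_props(3,4)[of l v] in \<open>auto simp: less_imp_le\<close>)

lemma K_equation: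
  assumes K: "(l, v) \<in> K" and t: "t \<in> {\<delta>..R}"
  shows "v t = phi1_inv (l * radial_avg N \<delta> (\<lambda>s. F s (U v s)) t)"
proof -
  have "radial_avg N \<delta> (G l v) t = radial_avg N \<delta> (\<lambda>s. F s (U v s)) t"
    using K_floor(2)[OF K] t by (intro radial_avg_cong) (auto simp: G_def max_absorb1)
  then show ?thesis using K_props(2)[OF K, of t] t by (simp add: slope_def)
qed

text \<open>A nontrivial solution lies above the floor. Its slope beyond \<open>m\<close> is at least the number \<open>e\<close> obtained
from the flux through \<open>m\<close>. If \<open>0 < e < \<eta> l\<close>, admissibility with \<open>e\<close> in place of \<open>\<eta> l\<close> gives
\<open>q / R ^ (N - 1) \<ge> 2 * e\<close> and the absurdity \<open>e \<ge> \<phi>\<^sub>1\<^sup>-\<^sup>1 (2 * e) > e\<close>. If \<open>e = 0\<close>, no flux passes \<open>m\<close>; then \<open>v\<close> vanishes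
on \<open>[\<delta>, m]\<close>, \<open>U v\<close> vanishes at \<open>m\<close>, and as a decreasing function it vanishes altogether.\<close>

lemma K_intro:
  fixes v :: "real \<Rightarrow>\<^sub>C real"
  assumes l: "0 \<le> l" and v_cl: "\<And>t. v (cl t) = v t"
    and eq: "\<And>t. t \<in> {\<delta>..R} \<Longrightarrow> v t = phi1_inv (l * radial_avg N \<delta> (\<lambda>s. F s (U v s)) t)"
    and nontrivial: "\<exists>t\<in>{\<delta>..R}. U v t \<noteq> 0"
  shows "(l, v) \<in> K"
proof -
  define g where "g s = F s (U v s)" for s
  have gc: "continuous_on {\<delta>..R} g" unfolding g_def by (intro F_cont continuous_intros U_cont) auto
  have g0: "0 \<le> g s" for s by (simp add: g_def F_nonneg)
  have eq': "v t = phi1_inv (l * radial_avg N \<delta> g t)" if "t \<in> {\<delta>..R}" for t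
    using eq[OF that] by (simp add: g_def[abs_def])
  have v0: "0 \<le> v t" if "t \<in> {\<delta>..R}" for t
    unfolding eq'[OF that] using that l g0
    by (intro phi1_inv_nonneg mult_nonneg_nonneg radial_avg_nonneg \<delta>_nonneg continuous_on_init[OF gc]) auto
  have v1: "v t \<le> 1" if "t \<in> {\<delta>..R}" for t
    unfolding eq'[OF that] using phi1_inv_abs_less[of "l * radial_avg N \<delta> g t"] by linarith
  have Ur: "0 \<le> U v s" "U v s \<le> R - \<delta>" if "s \<in> {\<delta>..R}" for s
    using that v0 v1 by (auto intro!: U_range)
  define q where "q = l * integral {\<delta>..m} (\<lambda>s. s ^ (N - 1) * g s)"
  define e where "e = phi1_inv (q / R ^ (N - 1))"
  have qint: "(\<lambda>s. s ^ (N - 1) * g s) integrable_on {\<delta>..r}" if "r \<le> R" for r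
    by (intro radial_integrable continuous_on_init[OF gc that])
  have q0: "0 \<le> q" unfolding q_def using l g0 m_between \<delta>_nonneg
    by (intro mult_nonneg_nonneg integral_nonneg qint) auto
  have e0: "0 \<le> e" unfolding e_def using q0 R_power_pos by (intro phi1_inv_nonneg divide_nonneg_pos)
  have ve: "e \<le> v t" if t: "t \<in> {m..R}" for t
  proof -
    have tpos: "0 < t" "t \<in> {\<delta>..R}" using t m_between \<delta>_nonneg by auto
    have "q \<le> l * integral {\<delta>..t} (\<lambda>s. s ^ (N - 1) * g s)"
      unfolding q_def using t l g0 m_between \<delta>_nonneg
      by (intro mult_left_mono integral_subset_le qint) auto
    then have "q / R ^ (N - 1) \<le> l * integral {\<delta>..t} (\<lambda>s. s ^ (N - 1) * g s) / t ^ (N - 1)"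
      using q0 tpos by (intro frac_le power_mono) auto
    then have "q / R ^ (N - 1) \<le> l * radial_avg N \<delta> g t" by (simp add: radial_avg_def)
    then show ?thesis unfolding eq'[OF tpos(2)] e_def by (rule phi1_inv_mono)
  qed
  have Ue: "e * \<psi> s \<le> U v s" if "s \<in> {\<delta>..R}" for s
    using that v0 ve e0 by (intro U_ge_floor) auto
  have epos: "0 < e"
  proof (rule ccontr)
    assume "\<not> 0 < e"
    have "q = 0"
    proof (rule ccontr)
      assume "q \<noteq> 0"
      then have "0 < q / R ^ (N - 1)" using q0 R_pos by simp
      then show False using phi1_inv_strict_mono \<open>\<not> 0 < e\<close> by (fastforce simp: e_def)
    qed
    have "v t = 0 \<and> (l = 0 \<or> U v m = 0)" if t: "t \<in> {\<delta>..m}" for t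
    proof (cases "l = 0")
      case True then show ?thesis using eq'[of t] t m_between by auto
    next
      case False
      then have "integral {\<delta>..m} (\<lambda>s. s ^ (N - 1) * g s) = 0" using \<open>q = 0\<close> by (simp add: q_def)
      moreover have "continuous_on {\<delta>..m} (\<lambda>s. s ^ (N - 1) * g s)"
        using m_between by (intro continuous_intros continuous_on_init[OF gc]) auto
      moreover have "0 \<le> s ^ (N - 1) * g s" if "s \<in> {\<delta>..m}" for s using that g0 \<delta>_nonneg by auto
      ultimately have z: "s ^ (N - 1) * g s = 0" if "s \<in> {\<delta>..m}" for s
        using integral_eq_0_iff[of \<delta> m "\<lambda>s. s ^ (N - 1) * g s"] m_between that by auto
      have "integral {\<delta>..t} (\<lambda>s. s ^ (N - 1) * g s) = integral {\<delta>..t} (\<lambda>s. 0)"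
        using z t by (intro integral_cong) auto
      then have "v t = 0" using eq'[of t] t m_between by (auto simp: radial_avg_def)
      moreover have "g m = 0" using z[of m] m_between \<delta>_nonneg by auto
      then have "U v m = 0" using F_pos[of "U v m" m] Ur(1)[of m] m_between by (force simp: g_def)
      ultimately show ?thesis by simp
    qed
    then have vz: "v t = 0" and lz: "l = 0 \<or> U v m = 0" if "t \<in> {\<delta>..m}" for t using that m_between by auto
    have "U v m = 0"
    proof (cases "l = 0")
      case True
      then have "U v m = U (\<lambda>_. 0) m" unfolding U_def using eq' m_between by (intro integral_cong) auto
      then show ?thesis by (simp add: U_def)
    qed (use lz[of m] m_between in auto)
    moreover have "integral {\<delta>..m} v + integral {m..R} v = integral {\<delta>..R} v"
      using m_between by (intro Henstock_Kurzweil_Integration.integral_combine integrable_continuous_interval) auto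
    moreover have "integral {\<delta>..m} v = integral {\<delta>..m} (\<lambda>_. 0)" using vz by (intro integral_cong) auto
    ultimately have "U v \<delta> = 0" by (simp add: U_def)
    then have "U v t = 0" if "t \<in> {\<delta>..R}" for t
      using U_decreasing[of v \<delta> t] v0 that Ur(1)[OF that] by auto
    then show False using nontrivial by blast
  qed
  have "\<eta> l \<le> e"
  proof (rule ccontr)
    assume less: "\<not> \<eta> l \<le> e"
    have "c0 * e \<le> l * g s" if s: "s \<in> {\<delta>..m}" for s
    proof -
      have sR: "s \<in> {\<delta>..R}" using s m_between by auto
      have "e * h \<le> U v s" using Ue[OF sR] s R_minus_m by (auto simp: \<psi>_def)
      then have "e \<le> min (\<eta> l) (U v s / h)" using less h_pos by (simp add: pos_le_divide_eq)
      then have "c0 * e \<le> c0 * min (\<eta> l) (U v s / h)" using c0_pos by (intro mult_left_mono) auto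
      also have "\<dots> \<le> l * F s (U v s)" using \<eta>_ok[OF l] Ur[OF sR] unfolding admissible_def by auto
      finally show ?thesis by (simp add: g_def)
    qed
    then have "c0 * e * J \<le> integral {\<delta>..m} (\<lambda>s. s ^ (N - 1) * (l * g s))"
      unfolding J_def using m_between \<delta>_nonneg l g0
      by (intro radial_integral_ge continuous_intros continuous_on_init[OF gc]) auto
    also have "\<dots> = integral {\<delta>..m} (\<lambda>s. l * (s ^ (N - 1) * g s))" by (simp add: mult_ac)
    also have "\<dots> = q" by (simp add: q_def integral_mult_right)
    finally have "2 * e \<le> q / R ^ (N - 1)"
      using J_pos R_pos by (simp add: c0_def pos_le_divide_eq mult_ac)
    then have "phi1_inv (2 * e) \<le> e" unfolding e_def by (intro phi1_inv_mono)
    moreover have "e < phi1_inv (2 * e)" using less \<eta>_le[OF l] e0 epos by (intro phi1_inv_double_ge(2)) auto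
    ultimately show False by simp
  qed
  then have "\<eta> l * \<psi> s \<le> U v s" if "s \<in> {\<delta>..R}" for s
    using Ue[OF that] mult_right_mono[OF \<open>\<eta> l \<le> e\<close> \<psi>_nonneg[of s]] that by auto
  then have Gg: "G l v s = g s" if "\<delta> \<le> s" "s \<le> R" for s using that by (simp add: G_def g_def max_absorb1)
  have "G l v s = g s" if "s \<in> {\<delta>..cl t}" for s t
    using that cl_le[of t] by (intro Gg) (auto intro: order_trans)
  then have "slope l v t = v t" for t
    unfolding slope_def v_cl[of t, symmetric] eq'[OF cl_mem]
    by (intro arg_cong[where f = phi1_inv] arg_cong[where f = "(*) l"] radial_avg_cong)
  then have "V l v = v" by (intro bcontfun_eqI) (simp add: apply_V[OF l])
  then show ?thesis using l by (simp add: K_def)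
qed

definition state :: "(real \<Rightarrow>\<^sub>C real) \<Rightarrow> real \<Rightarrow> real" where
  "state v = restrict (U v) {\<delta>..R}"

lemma state_apply: "r \<in> {\<delta>..R} \<Longrightarrow> state v r = U v r" by (simp add: state_def)

lemma state_deriv:
  fixes v :: "real \<Rightarrow>\<^sub>C real"
  assumes "r \<in> {\<delta>..R}"
  shows "(state v has_vector_derivative - v r) (at r within {\<delta>..R})"
  by (rule has_vector_derivative_transform[OF assms state_apply U_vector_derivative[OF _ assms]]) simp_all

lemma der_state:
  fixes v :: "real \<Rightarrow>\<^sub>C real"
  shows "r \<in> {\<delta>..R} \<Longrightarrow> der \<delta> R (state v) r = - v r"
  by (rule der_eqI[OF state_deriv]) (use \<delta>_less in auto)

lemma C1_onI:
  assumes d: "\<And>r. r \<in> {\<delta>..R} \<Longrightarrow> (u has_vector_derivative d r) (at r within {\<delta>..R})"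
    and c: "continuous_on {\<delta>..R} d"
  shows "C1_on \<delta> R u" "\<And>r. r \<in> {\<delta>..R} \<Longrightarrow> der \<delta> R u r = d r"
proof -
  show *: "der \<delta> R u r = d r" if "r \<in> {\<delta>..R}" for r
    by (rule der_eqI[OF d[OF that] that \<delta>_less])
  have "continuous_on {\<delta>..R} (der \<delta> R u) = continuous_on {\<delta>..R} d"
    using * by (intro continuous_on_cong) auto
  moreover have "u differentiable_on {\<delta>..R}"
    using d unfolding differentiable_on_def differentiable_def has_vector_derivative_def by blast
  ultimately show "C1_on \<delta> R u" unfolding C1_on_def using c by blast
qed

lemma state_C1: "C1_on \<delta> R (state v)"
  by (rule C1_onI(1)[where d = "\<lambda>r. - v r"]) (auto intro!: state_deriv continuous_intros)

lemma state_in_E: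
  fixes v :: "real \<Rightarrow>\<^sub>C real"
  shows "v \<delta> = 0 \<Longrightarrow> state v \<in> E_space \<delta> R"
  unfolding E_space_def using state_C1 der_state[of \<delta> v] state_apply[of R v] \<delta>_less by (auto simp: state_def)

lemma K_start:
  fixes v :: "real \<Rightarrow>\<^sub>C real"
  assumes "(l, v) \<in> K"
  shows "v \<delta> = 0"
  unfolding K_props(2)[OF assms, of \<delta>] slope_def using \<delta>_less by (simp add: radial_avg_def)

text \<open>Multiplying the fixed-point equation by \<open>r ^ (N - 1)\<close> shows that the flux is a primitive of
\<open>- l * r ^ (N - 1) * f r u\<close>.\<close>

lemma K_solution:
  assumes K: "(l, v) \<in> K"
  shows "is_solution N \<delta> R \<alpha> f l (state v)"
proof -
  define g where "g s = F s (U v s)" for s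
  have gc: "continuous_on {\<delta>..R} g" unfolding g_def by (intro F_cont continuous_intros U_cont) auto
  have gf: "g s = f s (state v s)" if "s \<in> {\<delta>..R}" for s
    using K_U_range[OF K that] that by (simp add: g_def state_apply F_eq)
  define Q where "Q r = integral {\<delta>..r} (\<lambda>s. s ^ (N - 1) * g s)" for r
  have flux: "r ^ (N - 1) * phi1 (der \<delta> R (state v) r) = - l * Q r" if r: "r \<in> {\<delta>..R}" for r
  proof -
    have "phi1 (der \<delta> R (state v) r) = - (l * radial_avg N \<delta> g r)"
      using K_equation[OF K r] by (simp add: der_state[OF r] phi1_minus phi1_phi1_inv g_def[abs_def])
    moreover have "r ^ (N - 1) * radial_avg N \<delta> g r = Q r"
    proof (cases "r = 0")
      case True
      then have "r = \<delta>" using r \<delta>_nonneg by auto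
      then show ?thesis using True N2 by (simp add: Q_def)
    qed (simp add: radial_avg_def Q_def)
    ultimately show ?thesis by (simp add: mult.left_commute)
  qed
  have Qd: "((\<lambda>r. r ^ (N - 1) * phi1 (der \<delta> R (state v) r)) has_vector_derivative - l * (r ^ (N - 1) * g r)) (at r within {\<delta>..R})"
    if r: "r \<in> {\<delta>..R}" for r
  proof (rule has_vector_derivative_transform[OF r flux])
    have "(Q has_vector_derivative r ^ (N - 1) * g r) (at r within {\<delta>..R})"
      unfolding Q_def by (intro integral_has_vector_derivative continuous_intros gc r)
    then show "((\<lambda>r. - l * Q r) has_vector_derivative - l * (r ^ (N - 1) * g r)) (at r within {\<delta>..R})"
      by (rule has_vector_derivative_mult_right)
  qed
  have cont: "continuous_on {\<delta>..R} (\<lambda>r. - l * (r ^ (N - 1) * g r))" by (intro continuous_intros gc)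
  have C1: "C1_on \<delta> R (\<lambda>r. r ^ (N - 1) * phi1 (der \<delta> R (state v) r))"
    by (rule C1_onI(1)[OF Qd cont])
  have der: "der \<delta> R (\<lambda>r. r ^ (N - 1) * phi1 (der \<delta> R (state v) r)) r = - l * (r ^ (N - 1) * g r)"
    if "r \<in> {\<delta>..R}" for r
    by (rule C1_onI(2)[OF Qd cont that])
  show ?thesis unfolding is_solution_def
  proof (intro conjI ballI)
    fix r assume r: "r \<in> {\<delta>..R}"
    show "0 \<le> state v r" "state v r < \<alpha>"
      using K_U_range[OF K r] \<alpha>_gt \<delta>_nonneg by (auto simp: state_apply[OF r])
    show "\<bar>der \<delta> R (state v) r\<bar> < 1" using K_props(3,4)[OF K, of r] by (simp add: der_state[OF r])
  next
    fix r assume "r \<in> {\<delta><..<R}"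
    then have r: "r \<in> {\<delta>..R}" by auto
    show "der \<delta> R (\<lambda>t. t ^ (N - 1) * phi1 (der \<delta> R (state v) t)) r + l * r ^ (N - 1) * f r (state v r) = 0"
      unfolding der[OF r] gf[OF r] by simp
  next
    show "der \<delta> R (state v) \<delta> = 0" using der_state[of \<delta> v] K_start[OF K] \<delta>_less by simp
    show "state v R = 0" using \<delta>_less by (simp add: state_apply)
  qed (rule state_C1 C1)+
qed

definition minus_der :: "(real \<Rightarrow> real) \<Rightarrow> real \<Rightarrow>\<^sub>C real" where
  "minus_der u = Bcontfun (\<lambda>t. - der \<delta> R u (cl t))"

lemma apply_minus_der:
  assumes "C1_on \<delta> R u"
  shows "apply_bcontfun (minus_der u) = (\<lambda>t. - der \<delta> R u (cl t))"
proof -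
  have c: "continuous_on {\<delta>..R} (der \<delta> R u)" using assms by (simp add: C1_on_def)
  have "continuous_on UNIV (\<lambda>t. - der \<delta> R u (cl t))"
    unfolding cl_def by (intro continuous_intros continuous_on_compose2[OF c]) (use \<delta>_less in auto)
  moreover have "norm (- der \<delta> R u (cl t)) \<le> sup_norm \<delta> R (der \<delta> R u)" for t
    using sup_norm_upper[OF c cl_mem[of t]] by simp
  ultimately show ?thesis unfolding minus_der_def
    by (intro Bcontfun_inverse bcontfun_normI)
qed

lemma U_minus_der:
  assumes u: "C1_on \<delta> R u" "u R = 0" and r: "r \<in> {\<delta>..R}"
  shows "U (minus_der u) r = u r"
proof -
  have "(u has_vector_derivative der \<delta> R u x) (at x within {r..R})" if "x \<in> {r..R}" for x
    using der_works[OF u(1), of x] that r by (auto intro: has_vector_derivative_within_subset)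
  then have "(der \<delta> R u has_integral (u R - u r)) {r..R}"
    using r by (intro fundamental_theorem_of_calculus) auto
  then have "integral {r..R} (der \<delta> R u) = - u r" using u(2) by (simp add: integral_unique)
  moreover have "U (minus_der u) r = integral {r..R} (\<lambda>t. - der \<delta> R u t)"
    unfolding U_def apply_minus_der[OF u(1)] using r by (intro integral_cong) auto
  ultimately show ?thesis by simp
qed

lemma state_minus_der:
  assumes "u \<in> E_space \<delta> R"
  shows "state (minus_der u) = u"
  using assms U_minus_der[of u] unfolding E_space_def state_def
  by (auto intro!: extensionalityI[of _ "{\<delta>..R}"])

lemma minus_der_state:
  fixes v :: "real \<Rightarrow>\<^sub>C real"
  assumes "\<And>t. v (cl t) = v t"
  shows "minus_der (state v) = v"
  by (rule bcontfun_eqI) (simp add: apply_minus_der[OF state_C1] der_state assms)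

text \<open>Integrating the equation from \<open>\<delta>\<close>, where the flux vanishes, and solving for \<open>u'\<close> gives the
fixed-point equation without the floor.\<close>

lemma solution_in_K:
  assumes l: "0 \<le> l" and sol: "is_solution N \<delta> R \<alpha> f l u" and nt: "\<exists>r\<in>{\<delta>..R}. u r \<noteq> 0"
  shows "(l, minus_der u) \<in> K"
proof (rule K_intro[OF l])
  let ?v = "minus_der u"
  have C1: "C1_on \<delta> R u" and uR: "u R = 0" and u\<delta>: "der \<delta> R u \<delta> = 0"
    and ur: "\<And>r. r \<in> {\<delta>..R} \<Longrightarrow> 0 \<le> u r" and d1: "\<And>r. r \<in> {\<delta>..R} \<Longrightarrow> \<bar>der \<delta> R u r\<bar> < 1"
    and P1: "C1_on \<delta> R (\<lambda>r. r ^ (N - 1) * phi1 (der \<delta> R u r))"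
    and ode: "\<And>r. r \<in> {\<delta><..<R} \<Longrightarrow> der \<delta> R (\<lambda>t. t ^ (N - 1) * phi1 (der \<delta> R u t)) r + l * r ^ (N - 1) * f r (u r) = 0"
    using sol by (auto simp: is_solution_def)
  note v = apply_minus_der[OF C1]
  note Uu = U_minus_der[OF C1 uR]
  show "?v (cl t) = ?v t" for t by (simp add: v)
  show "\<exists>t\<in>{\<delta>..R}. U ?v t \<noteq> 0" using nt Uu by auto
  have v1: "?v t \<le> 1" for t using d1[of "cl t"] by (simp add: v abs_less_iff less_imp_le)
  have uub: "u r \<le> R - \<delta>" if "r \<in> {\<delta>..R}" for r
  proof -
    have "U ?v r \<le> U (\<lambda>_. 1) r" using that v1 by (intro U_mono) auto
    also have "U (\<lambda>_. 1) r = R - r" using that by (simp add: U_def)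
    finally show ?thesis using Uu[OF that] that by auto
  qed
  define g where "g s = F s (U ?v s)" for s
  have gf: "g s = f s (u s)" if "s \<in> {\<delta>..R}" for s
    using ur[OF that] uub[OF that] that by (simp add: g_def Uu F_eq)
  have gc: "continuous_on {\<delta>..R} g" unfolding g_def by (intro F_cont continuous_intros U_cont) auto
  show "?v t = phi1_inv (l * radial_avg N \<delta> (\<lambda>s. F s (U ?v s)) t)" if t: "t \<in> {\<delta>..R}" for t
  proof (cases "t = 0")
    case True
    then have "t = \<delta>" using t \<delta>_nonneg by auto
    then show ?thesis using u\<delta> t by (simp add: v radial_avg_def)
  next
    case False
    define P where "P t = t ^ (N - 1) * phi1 (der \<delta> R u t)" for t
    have Pc: "C1_on \<delta> R P" using P1 by (simp add: P_def[abs_def])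
    have "((\<lambda>s. - l * (s ^ (N - 1) * g s)) has_integral (P t - P \<delta>)) {\<delta>..t}"
    proof (rule fundamental_theorem_of_calculus_interior)
      show "\<delta> \<le> t" using t by simp
      show "continuous_on {\<delta>..t} P"
        using C1_on_continuous[OF Pc] by (rule continuous_on_subset) (use t in auto)
      fix s assume s: "s \<in> {\<delta><..<t}"
      then have "s \<in> {\<delta>..R}" "s \<in> {\<delta><..<R}" using t by auto
      moreover from this have "der \<delta> R P s = - l * (s ^ (N - 1) * g s)"
        using ode[of s] by (simp add: P_def[abs_def] gf)
      ultimately show "(P has_vector_derivative - l * (s ^ (N - 1) * g s)) (at s)"
        using der_works[OF Pc, of s] at_within_Icc_at[of \<delta> s R] by simp
    qed
    then have "P t - P \<delta> = integral {\<delta>..t} (\<lambda>s. - l * (s ^ (N - 1) * g s))" by (rule integral_unique[symmetric])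
    then have "P t = - l * integral {\<delta>..t} (\<lambda>s. s ^ (N - 1) * g s)"
      by (simp add: P_def u\<delta> phi1_def)
    then have "phi1 (der \<delta> R u t) = - (l * radial_avg N \<delta> g t)"
      using False by (simp add: P_def radial_avg_def field_simps)
    then have "der \<delta> R u t = - phi1_inv (l * radial_avg N \<delta> g t)"
      using phi1_inv_phi1[OF d1[OF t]] by (simp add: phi1_inv_minus)
    then show ?thesis using t by (simp add: v g_def[abs_def])
  qed
qed

definition \<Phi> :: "real \<times> (real \<Rightarrow>\<^sub>C real) \<Rightarrow> real \<times> (real \<Rightarrow> real)" where
  "\<Phi> z = (fst z, state (snd z))"

lemma K_positive:
  assumes "(l, v) \<in> K" "(l, v) \<noteq> (0, 0)"
  shows "0 < l" "0 < \<eta> l"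
proof -
  show "0 < l" using assms K_at_0[of v] K_props(1)[OF assms(1)] by (cases "l = 0") auto
  then show "0 < \<eta> l" by (rule \<eta>_pos)
qed

lemma nontrivial_solutions_eq: "nontrivial_solutions N \<delta> R \<alpha> f = \<Phi> ` (K - {(0, 0)})"
proof (intro set_eqI iffI)
  fix x assume "x \<in> nontrivial_solutions N \<delta> R \<alpha> f"
  then obtain l u where x: "x = (l, u)" "0 \<le> l" "u \<in> extensional {\<delta>..R}" "is_solution N \<delta> R \<alpha> f l u"
    "\<exists>r\<in>{\<delta>..R}. u r \<noteq> 0" unfolding nontrivial_solutions_def by blast
  have uE: "u \<in> E_space \<delta> R" using x(3,4) by (simp add: E_space_def is_solution_def)
  have K: "(l, minus_der u) \<in> K" by (rule solution_in_K[OF x(2,4,5)])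
  have "minus_der u \<noteq> 0"
  proof
    assume "minus_der u = 0"
    then have "u r = 0" if "r \<in> {\<delta>..R}" for r
      using U_minus_der[of u r] uE that by (auto simp: E_space_def U_def)
    then show False using x(5) by blast
  qed
  then show "x \<in> \<Phi> ` (K - {(0, 0)})"
    using K x(1) state_minus_der[OF uE] by (auto simp: \<Phi>_def intro!: image_eqI[of _ _ "(l, minus_der u)"])
next
  fix x assume "x \<in> \<Phi> ` (K - {(0, 0)})"
  then obtain z where z: "z \<in> K" "z \<noteq> (0, 0)" "x = \<Phi> z" by blast
  obtain l v where "z = (l, v)" by (cases z)
  with z have K: "(l, v) \<in> K" "(l, v) \<noteq> (0, 0)" and x: "x = (l, state v)" by (simp_all add: \<Phi>_def)
  have "0 < \<eta> l * \<psi> \<delta>" using K_positive(2)[OF K] h_pos \<delta>_less by (simp add: \<psi>_def)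
  also have "\<dots> \<le> U v \<delta>" using K_floor(2)[OF K(1)] \<delta>_less by simp
  finally have "state v \<delta> \<noteq> 0" using \<delta>_less by (simp add: state_apply)
  then show "x \<in> nontrivial_solutions N \<delta> R \<alpha> f"
    using K_solution[OF K(1)] K_props(1)[OF K(1)] \<delta>_less
    by (auto simp: nontrivial_solutions_def x state_def[of v])
qed

section \<open>The solution set in the space \<open>E\<^sub>\<delta>\<close>\<close>

lemma Metric_E: "Metric_space (E_space \<delta> R) (E_dist \<delta> R)"
  by (rule Metric_space_E[OF \<delta>_less])

lemma topspace_E: "topspace (E_top \<delta> R) = E_space \<delta> R"
  unfolding E_top_def by (rule Metric_space.topspace_mtopology[OF Metric_E])

lemma topspace_RE: "topspace (RE_top \<delta> R) = UNIV \<times> E_space \<delta> R"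
  by (simp add: RE_top_def topspace_E)

lemma E_dist_state_le:
  fixes v w :: "real \<Rightarrow>\<^sub>C real"
  assumes "v \<delta> = 0" "w \<delta> = 0"
  shows "E_dist \<delta> R (state v) (state w) \<le> (R - \<delta> + 1) * dist v w"
proof -
  have "sup_norm \<delta> R (\<lambda>r. state v r - state w r) \<le> (R - \<delta>) * dist v w"
    by (rule sup_norm_least[OF \<delta>_less]) (simp add: state_apply U_dist)
  moreover have "sup_norm \<delta> R (\<lambda>r. der \<delta> R (state v) r - der \<delta> R (state w) r) \<le> dist v w"
  proof (rule sup_norm_least[OF \<delta>_less])
    fix r assume "r \<in> {\<delta>..R}"
    then show "\<bar>der \<delta> R (state v) r - der \<delta> R (state w) r\<bar> \<le> dist v w"
      using dist_bounded[of v r w] by (simp add: der_state dist_real_def abs_minus_commute)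
  qed
  ultimately show ?thesis
    using E_dist_eq[OF state_in_E state_in_E \<delta>_less, of v w] assms by (simp add: algebra_simps)
qed

lemma E_dist_der_le:
  assumes "u \<in> E_space \<delta> R" "w \<in> E_space \<delta> R" "r \<in> {\<delta>..R}"
  shows "\<bar>der \<delta> R u r - der \<delta> R w r\<bar> \<le> E_dist \<delta> R u w"
proof -
  have c: "continuous_on {\<delta>..R} (\<lambda>r. u r - w r)" "continuous_on {\<delta>..R} (\<lambda>r. der \<delta> R u r - der \<delta> R w r)"
    using assms C1_on_continuous unfolding E_space_def C1_on_def by (auto intro!: continuous_on_diff)
  have "0 \<le> sup_norm \<delta> R (\<lambda>r. u r - w r)"
    using sup_norm_upper[OF c(1) assms(3)] abs_ge_zero order_trans by blast
  then show ?thesis using sup_norm_upper[OF c(2) assms(3)] E_dist_eq[OF assms(1,2) \<delta>_less] by linarith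
qed

lemma continuous_map_\<Phi>: "continuous_map (top_of_set K) (RE_top \<delta> R) \<Phi>"
  unfolding RE_top_def \<Phi>_def
proof (rule continuous_map_pairedI)
  show "continuous_map (top_of_set K) euclideanreal fst"
    by (auto intro!: continuous_intros)
  show "continuous_map (top_of_set K) (E_top \<delta> R) (\<lambda>z. state (snd z))"
    unfolding E_top_def Metric_space.continuous_map_to_metric[OF Metric_E]
  proof (intro ballI allI impI)
    fix z :: "real \<times> (real \<Rightarrow>\<^sub>C real)" and e :: real assume z: "z \<in> topspace (top_of_set K)" and e: "0 < e"
    have start: "snd y \<delta> = 0" if "y \<in> K" for y using K_start[of "fst y" "snd y"] that by simp
    define B where "B = K \<inter> ball z (e / (R - \<delta> + 1))"
    have Rd: "0 < R - \<delta> + 1" using \<delta>_less by simp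
    have "state (snd y) \<in> Metric_space.mball (E_space \<delta> R) (E_dist \<delta> R) (state (snd z)) e" if y: "y \<in> B" for y
    proof -
      have "E_dist \<delta> R (state (snd z)) (state (snd y)) \<le> (R - \<delta> + 1) * dist (snd z) (snd y)"
        using start z y by (intro E_dist_state_le) (auto simp: B_def)
      also have "\<dots> \<le> (R - \<delta> + 1) * dist z y" using Rd by (intro mult_left_mono dist_snd_le) auto
      also have "\<dots> < e" using y Rd by (simp add: B_def pos_less_divide_eq mult.commute)
      finally show ?thesis
        using state_in_E[OF start, of z] state_in_E[OF start, of y] z y
        by (simp add: Metric_space.in_mball[OF Metric_E] B_def)
    qed
    moreover have "openin (top_of_set K) B" "z \<in> B"
      using z e Rd by (auto simp: B_def openin_open)
    ultimately show "\<exists>B. openin (top_of_set K) B \<and> z \<in> B \<and>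
        (\<forall>y\<in>B. state (snd y) \<in> Metric_space.mball (E_space \<delta> R) (E_dist \<delta> R) (state (snd z)) e)" by blast
  qed
qed

text \<open>Continuity of the inverse of \<open>\<Phi>\<close>; it makes the image of \<open>K\<close> closed.\<close>

lemma continuous_map_minus_der: "continuous_map (E_top \<delta> R) euclidean minus_der"
  unfolding E_top_def Metric_space.continuous_map_from_metric[OF Metric_E]
proof (intro conjI ballI allI impI)
  fix u B assume u: "u \<in> E_space \<delta> R" and B: "openin euclidean B \<and> minus_der u \<in> B"
  then obtain e where e: "0 < e" "ball (minus_der u) e \<subseteq> B" by (auto simp: open_contains_ball)
  have "minus_der w \<in> B" if w: "w \<in> E_space \<delta> R" "E_dist \<delta> R u w < e" for w
  proof -
    have C1: "C1_on \<delta> R u" "C1_on \<delta> R w" using u w by (auto simp: E_space_def)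
    have "dist (minus_der u) (minus_der w) \<le> E_dist \<delta> R u w"
    proof (rule dist_bound)
      fix t
      show "dist (minus_der u t) (minus_der w t) \<le> E_dist \<delta> R u w"
        using E_dist_der_le[OF u w(1) cl_mem[of t]]
        by (simp add: apply_minus_der[OF C1(1)] apply_minus_der[OF C1(2)] dist_real_def abs_minus_commute)
    qed
    then show ?thesis using w(2) e(2) by auto
  qed
  then show "\<exists>r>0. \<forall>x. x \<in> E_space \<delta> R \<and> E_dist \<delta> R u x < r \<longrightarrow> minus_der x \<in> B" using e(1) by blast
qed auto

lemma closedin_\<Phi>_K: "closedin (RE_top \<delta> R) (\<Phi> ` K)"
proof -
  define \<Psi> where "\<Psi> z = (fst z, minus_der (snd z))" for z :: "real \<times> (real \<Rightarrow> real)"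
  have "continuous_map (RE_top \<delta> R) (prod_topology euclideanreal euclidean) \<Psi>"
    unfolding \<Psi>_def RE_top_def
    by (intro continuous_map_pairedI continuous_map_fst continuous_map_compose[OF continuous_map_snd continuous_map_minus_der, unfolded o_def])
  then have "continuous_map (RE_top \<delta> R) euclidean \<Psi>" by (simp add: euclidean_product_topology)
  then have "closedin (RE_top \<delta> R) {z \<in> topspace (RE_top \<delta> R). \<Psi> z \<in> K}"
    by (rule closedin_continuous_map_preimage) (simp add: closed_K)
  also have "{z \<in> topspace (RE_top \<delta> R). \<Psi> z \<in> K} = \<Phi> ` K"
  proof (intro set_eqI iffI)
    fix z assume z: "z \<in> {z \<in> topspace (RE_top \<delta> R). \<Psi> z \<in> K}"
    then have "\<Phi> (\<Psi> z) = z" by (auto simp: \<Phi>_def \<Psi>_def topspace_RE state_minus_der)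
    then show "z \<in> \<Phi> ` K" using z by (metis (no_types, lifting) imageI mem_Collect_eq)
  next
    fix z assume "z \<in> \<Phi> ` K"
    then obtain l v where K: "(l, v) \<in> K" and z: "z = (l, state v)" by (auto simp: \<Phi>_def)
    have "minus_der (state v) = v" by (rule minus_der_state) (rule K_props(5)[OF K])
    then show "z \<in> {z \<in> topspace (RE_top \<delta> R). \<Psi> z \<in> K}"
      using K K_start[OF K] by (simp add: z \<Psi>_def topspace_RE state_in_E)
  qed
  finally show ?thesis .
qed

lemma Sigma_subset: "Sigma_set N \<delta> R \<alpha> f \<subseteq> \<Phi> ` K"
  unfolding Sigma_set_def nontrivial_solutions_eq
  by (intro closure_of_minimal closedin_\<Phi>_K) auto

text \<open>The continua over \<open>[0, b]\<close> all pass through \<open>(0, 0)\<close>, so their union over all \<open>b\<close> is connected.\<close>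

lemma K_branch:
  obtains T where "connected T" "T \<subseteq> K" "(0, 0) \<in> T" "fst ` T = {0..}"
proof -
  have "\<exists>S. connected S \<and> S \<subseteq> K \<and> (0, 0) \<in> S \<and> (\<exists>v. (b, v) \<in> S)" if "0 \<le> b" for b
    by (rule K_continuum[OF that]) blast
  then obtain S where S: "\<And>b. 0 \<le> b \<Longrightarrow> connected (S b)" "\<And>b. 0 \<le> b \<Longrightarrow> S b \<subseteq> K"
    "\<And>b. 0 \<le> b \<Longrightarrow> (0, 0) \<in> S b" "\<And>b. 0 \<le> b \<Longrightarrow> \<exists>v. (b, v) \<in> S b" by metis
  show thesis
  proof (rule that[of "\<Union>b\<in>{0..}. S b"])
    show "connected (\<Union>b\<in>{0..}. S b)" 
    proof (rule connected_Union)
      show "connected s" if "s \<in> S ` {0..}" for s using that S(1) by auto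
      have "(0, 0) \<in> \<Inter> (S ` {0..})" using S(3) by auto
      then show "\<Inter> (S ` {0..}) \<noteq> {}" by blast
    qed
    show sub: "(\<Union>b\<in>{0..}. S b) \<subseteq> K" using S(2) by auto
    show "(0, 0) \<in> (\<Union>b\<in>{0..}. S b)" using S(3)[of 0] by auto
    show "fst ` (\<Union>b\<in>{0..}. S b) = {0..}"
    proof
      show "fst ` (\<Union>b\<in>{0..}. S b) \<subseteq> {0..}" using sub K_props(1) by force
      show "{0..} \<subseteq> fst ` (\<Union>b\<in>{0..}. S b)" using S(4) by (force intro: rev_image_eqI)
    qed
  qed
qed

lemma \<Phi>_zero: "\<Phi> (0, 0) = (0, E_zero \<delta> R)"
  by (auto simp: \<Phi>_def state_def E_zero_def U_def)

text \<open>The floor gives \<open>u r \<ge> c * (R - r)\<close> with \<open>c > 0\<close>. A function \<open>w\<close> whose derivative differs from \<open>u'\<close> by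
less than \<open>c\<close> satisfies \<open>w r \<ge> u r - c * (R - r)\<close>, as both vanish at \<open>R\<close>.\<close>

lemma state_in_int_P:
  assumes K: "(l, v) \<in> K" "(l, v) \<noteq> (0, 0)"
  shows "state v \<in> int_P \<delta> R"
proof -
  define c where "c = \<eta> l / 2"
  have c: "0 < c" using K_positive(2)[OF K] by (simp add: c_def)
  have vE: "state v \<in> E_space \<delta> R" by (rule state_in_E[OF K_start[OF K(1)]])
  have lower: "c * (R - r) \<le> U v r" if r: "r \<in> {\<delta>..R}" for r
  proof -
    have "(R - r) / 2 \<le> \<psi> r" using r by (auto simp: \<psi>_def h_def)
    then have "\<eta> l * ((R - r) / 2) \<le> \<eta> l * \<psi> r" using \<eta>_nonneg by (rule mult_left_mono)
    also have "\<dots> \<le> U v r" by (rule K_floor(2)[OF K(1) r])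
    finally show ?thesis by (simp add: c_def)
  qed
  have "Metric_space.mball (E_space \<delta> R) (E_dist \<delta> R) (state v) c \<subseteq> P_cone \<delta> R"
  proof
    fix w assume "w \<in> Metric_space.mball (E_space \<delta> R) (E_dist \<delta> R) (state v) c"
    then have w: "w \<in> E_space \<delta> R" "E_dist \<delta> R (state v) w < c"
      by (auto simp: Metric_space.in_mball[OF Metric_E])
    have C1: "C1_on \<delta> R w" "w R = 0" using w(1) by (auto simp: E_space_def)
    have "0 \<le> w r" if r: "r \<in> {\<delta>..R}" for r
    proof -
      have "v t - c \<le> minus_der w t" if t: "t \<in> {r..R}" for t
      proof -
        have tR: "t \<in> {\<delta>..R}" using t r by auto
        then show ?thesis using E_dist_der_le[OF vE w(1) tR] w(2)
          by (simp add: der_state apply_minus_der[OF C1(1)] abs_le_iff)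
      qed
      then have "U (\<lambda>t. v t - c) r \<le> U (minus_der w) r"
        using r by (intro U_mono continuous_intros) auto
      also have "U (\<lambda>t. v t - c) r = U v r - U (\<lambda>_. c) r"
        using r by (intro U_diff[symmetric]) auto
      finally have "U v r - c * (R - r) \<le> w r"
        using r by (simp add: U_minus_der[OF C1 r]) (simp add: U_def mult.commute)
      then show ?thesis using lower[OF r] by linarith
    qed
    then show "w \<in> P_cone \<delta> R" using w(1) by (simp add: P_cone_def)
  qed
  then show ?thesis unfolding int_P_def E_top_def
    using vE c Metric_space.openin_mball[OF Metric_E] Metric_space.centre_in_mball_iff[OF Metric_E]
    by (meson interior_of_maximal subsetD)
qed

lemma nontrivial_subset_topspace: "nontrivial_solutions N \<delta> R \<alpha> f \<subseteq> topspace (RE_top \<delta> R)"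
proof -
  have "\<Phi> ` K \<subseteq> topspace (RE_top \<delta> R)" by (rule closedin_subset[OF closedin_\<Phi>_K])
  then show ?thesis unfolding nontrivial_solutions_eq by auto
qed

text \<open>The trivial pair is not itself a nontrivial solution, but a connected set with a second point has no isolated
points, so it is a limit of nontrivial solutions.\<close>

lemma branch_in_Sigma:
  assumes T: "connected T" "T \<subseteq> K" "(0, 0) \<in> T" and nontrivial: "y \<in> T" "y \<noteq> (0, 0)"
  shows "\<Phi> ` T \<subseteq> Sigma_set N \<delta> R \<alpha> f"
proof -
  have "T \<noteq> {x}" for x using T(3) nontrivial by auto
  then have "(0, 0) islimpt T" by (rule connected_imp_perfect[OF T(1) T(3)])
  then have "(0, 0) \<in> top_of_set K closure_of (T - {(0, 0)})"
    unfolding in_closure_of openin_open islimpt_def topspace_subtopology topspace_euclidean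
    using T(2,3) by blast
  then have "\<Phi> (0, 0) \<in> RE_top \<delta> R closure_of (\<Phi> ` (T - {(0, 0)}))"
    using continuous_map_image_closure_subset[OF continuous_map_\<Phi>] by blast
  also have "\<dots> \<subseteq> RE_top \<delta> R closure_of (\<Phi> ` (K - {(0, 0)}))"
    using T by (intro closure_of_mono image_mono) auto
  finally have "\<Phi> (0, 0) \<in> Sigma_set N \<delta> R \<alpha> f" by (simp add: Sigma_set_def nontrivial_solutions_eq)
  moreover have "\<Phi> ` (K - {(0, 0)}) \<subseteq> Sigma_set N \<delta> R \<alpha> f"
    unfolding Sigma_set_def using closure_of_subset[OF nontrivial_subset_topspace] by (simp add: nontrivial_solutions_eq)
  ultimately have "insert (\<Phi> (0, 0)) (\<Phi> ` (K - {(0, 0)})) \<subseteq> Sigma_set N \<delta> R \<alpha> f"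
    by (simp only: insert_subset)
  moreover have "\<Phi> ` T \<subseteq> insert (\<Phi> (0, 0)) (\<Phi> ` (K - {(0, 0)}))"
  proof (rule image_subsetI)
    fix x assume "x \<in> T"
    then show "\<Phi> x \<in> insert (\<Phi> (0, 0)) (\<Phi> ` (K - {(0, 0)}))" using T(2) by (cases "x = (0, 0)") auto
  qed
  ultimately show ?thesis by (rule order_trans[rotated])
qed

section \<open>Large parameters\<close>

text \<open>For \<open>l \<ge> 1\<close> the floor has amplitude at least \<open>c\<close>, so \<open>U v \<ge> c * h\<close> on \<open>[\<delta>, a]\<close>. Admissibility at
the fixed parameter \<open>1\<close> converts this into a lower bound \<open>g0\<close> for the nonlinearity that does not depend
on \<open>l\<close>. The radial average is then at least \<open>\<kappa>\<close> beyond \<open>a\<close>, and the slope is at least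
\<open>\<phi>\<^sub>1\<^sup>-\<^sup>1 (l * \<kappa>)\<close>.\<close>

lemma K_asymptotic:
  assumes e: "0 < e" "e < 1"
  shows "\<exists>L. \<forall>l v. (l, v) \<in> K \<longrightarrow> L \<le> l \<longrightarrow> (\<forall>t\<in>{\<delta> + e..R}. 1 - e \<le> v t)"
proof -
  obtain c where c: "0 < c" "\<And>l. 1 \<le> l \<Longrightarrow> c \<le> \<eta> l" using \<eta>_lower[of 1] by auto
  \<comment> \<open>The floor is flat only up to \<open>m\<close>, hence the minimum.\<close>
  define a where "a = \<delta> + min e h"
  have "\<delta> + h = m" by (simp add: m_def h_def field_simps)
  have a: "\<delta> < a" "a \<le> \<delta> + e" "a \<le> m"
    using e h_pos min.cobounded2[of e h] by (auto simp: a_def \<open>\<delta> + h = m\<close>[symmetric])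
  define g0 where "g0 = c0 * min (\<eta> 1) c"
  have g0: "0 < g0" using c0_pos c \<eta>_pos[of 1] by (simp add: g0_def)
  define \<kappa> where "\<kappa> = g0 * integral {\<delta>..a} (\<lambda>s. s ^ (N - 1)) / R ^ (N - 1)"
  have \<kappa>: "0 < \<kappa>" using g0 radial_integral_pos[OF \<delta>_nonneg a(1), of "N - 1"] R_power_pos by (simp add: \<kappa>_def)
  have "1 - e \<le> v t" if K: "(l, v) \<in> K" and l: "max 1 (phi1 (1 - e) / \<kappa>) \<le> l" and t: "t \<in> {\<delta> + e..R}" for l v t
  proof -
    have tR: "t \<in> {\<delta>..R}" using t e by auto
    have "g0 \<le> F s (U v s)" if s: "s \<in> {\<delta>..a}" for s
    proof -
      have sR: "s \<in> {\<delta>..R}" using s a m_between by auto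
      have "\<psi> s = h" using s a R_minus_m by (auto simp: \<psi>_def)
      then have "\<eta> l * h \<le> U v s" using K_floor(2)[OF K sR] by simp
      moreover have "c * h \<le> \<eta> l * h" using c l h_pos by (intro mult_right_mono) auto
      ultimately have "c * h \<le> U v s" by linarith
      then have "c \<le> U v s / h" using h_pos by (simp add: pos_le_divide_eq)
      then have "g0 \<le> c0 * min (\<eta> 1) (U v s / h)" unfolding g0_def using c0_pos by (intro mult_left_mono) auto
      also have "\<dots> \<le> 1 * F s (U v s)" using \<eta>_ok[of 1] K_U_range[OF K sR] unfolding admissible_def by auto
      finally show ?thesis by simp
    qed
    then have "\<kappa> \<le> radial_avg N \<delta> (\<lambda>s. F s (U v s)) t"
      unfolding \<kappa>_def using a t g0 by (intro radial_avg_ge F_cont continuous_intros U_cont) (auto simp: F_nonneg)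
    then have "l * \<kappa> \<le> l * radial_avg N \<delta> (\<lambda>s. F s (U v s)) t" using l by (intro mult_left_mono) auto
    moreover have "phi1 (1 - e) \<le> l * \<kappa>" using l \<kappa> by (simp add: pos_divide_le_eq)
    ultimately have "phi1_inv (phi1 (1 - e)) \<le> v t"
      unfolding K_equation[OF K tR] by (intro phi1_inv_mono) linarith
    then show ?thesis using phi1_inv_phi1[of "1 - e"] e by simp
  qed
  then show ?thesis by (intro exI[of _ "max 1 (phi1 (1 - e) / \<kappa>)"]) blast
qed

text \<open>The exceptional set lies in \<open>[\<delta>, \<delta> + d]\<close> once \<open>u'\<close> is close to \<open>-1\<close> beyond \<open>\<delta> + d\<close>.\<close>

lemma K_measure:
  assumes n: "n \<ge> 1" and e: "0 < e"
  shows "\<exists>L. \<forall>l v. (l, v) \<in> K \<longrightarrow> L \<le> l \<longrightarrow>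
    measure lebesgue {r\<in>{\<delta>..R}. \<bar>der \<delta> R (state v) r - (-1)\<bar> > 1 / real n} \<le> e"
proof -
  define d where "d = min e (min (1 / real n) (1 / 2))"
  have d: "0 < d" "d < 1" "d \<le> e" "d \<le> 1 / real n" using e n by (auto simp: d_def)
  obtain L where L: "\<And>l v. (l, v) \<in> K \<Longrightarrow> L \<le> l \<Longrightarrow> \<forall>t\<in>{\<delta> + d..R}. 1 - d \<le> apply_bcontfun v t"
    using K_asymptotic[OF d(1,2)] by blast
  have "measure lebesgue {r\<in>{\<delta>..R}. \<bar>der \<delta> R (state v) r - (-1)\<bar> > 1 / real n} \<le> e" (is "measure _ ?A \<le> e")
    if K: "(l, v) \<in> K" and l: "L \<le> l" for l v
  proof (cases "?A \<in> sets lebesgue")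
    case True
    have "?A \<subseteq> {\<delta>..\<delta> + d}"
    proof
      fix r assume r: "r \<in> ?A"
      then have r1: "r \<in> {\<delta>..R}" "\<bar>1 - v r\<bar> > 1 / real n" by (auto simp: der_state)
      then have "v r < 1 - d" using K_props(4)[OF K, of r] d(4) by simp
      then have "r < \<delta> + d" using L[OF K l] r1(1) by (meson atLeastAtMost_iff linorder_not_le)
      then show "r \<in> {\<delta>..\<delta> + d}" using r1(1) by simp
    qed
    then have "measure lebesgue ?A \<le> measure lebesgue {\<delta>..\<delta> + d}"
      using True by (intro measure_mono_fmeasurable) auto
    also have "\<dots> \<le> e" using d by simp
    finally show ?thesis .
  next
    \<comment> \<open>A set that is not measurable has measure \<open>0\<close> by convention.\<close>
    case False then show ?thesis using e by (simp add: measure_notin_sets)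
  qed
  then show ?thesis by blast
qed

text \<open>The bound \<open>u \<le> R - \<delta>\<close> holds throughout; conversely \<open>u (\<delta> + d)\<close> is nearly \<open>R - (\<delta> + d)\<close> if the slope
beyond \<open>\<delta> + d\<close> is nearly \<open>-1\<close>.\<close>

lemma K_sup_norm:
  assumes e: "0 < e"
  shows "\<exists>L. \<forall>l v. (l, v) \<in> K \<longrightarrow> L \<le> l \<longrightarrow> \<bar>sup_norm \<delta> R (state v) - (R - \<delta>)\<bar> \<le> e"
proof -
  define d where "d = min (min (1 / 2) h) (e / (1 + (R - \<delta>)))"
  have d: "0 < d" "d < 1" "d \<le> h" "d \<le> e / (1 + (R - \<delta>))" using e h_pos \<delta>_less by (auto simp: d_def)
  have de: "d * (1 + (R - \<delta>)) \<le> e" using d(4) \<delta>_less by (simp add: pos_le_divide_eq)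
  obtain L where L: "\<And>l v. (l, v) \<in> K \<Longrightarrow> L \<le> l \<Longrightarrow> \<forall>t\<in>{\<delta> + d..R}. 1 - d \<le> apply_bcontfun v t"
    using K_asymptotic[OF d(1,2)] by blast
  have "\<bar>sup_norm \<delta> R (state v) - (R - \<delta>)\<bar> \<le> e" if K: "(l, v) \<in> K" and l: "L \<le> l" for l v
  proof -
    have rd: "\<delta> + d \<in> {\<delta>..R}" using d h_pos by (auto simp: h_def)
    have "sup_norm \<delta> R (state v) \<le> R - \<delta>"
      by (rule sup_norm_least[OF \<delta>_less]) (use K_U_range[OF K] in \<open>auto simp: state_apply\<close>)
    moreover have "(1 - d) * (R - (\<delta> + d)) \<le> sup_norm \<delta> R (state v)"
    proof -
      have "U (\<lambda>_. 1 - d) (\<delta> + d) \<le> U v (\<delta> + d)"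
        using L[OF K l] rd by (intro U_mono) auto
      also have "\<dots> = state v (\<delta> + d)" using state_apply[OF rd] by simp
      also have "\<dots> \<le> sup_norm \<delta> R (state v)"
        using sup_norm_upper[OF C1_on_continuous[OF state_C1] rd, of v] by (rule order_trans[OF abs_ge_self])
      finally show ?thesis using rd by (simp add: U_def mult.commute)
    qed
    moreover have "R - \<delta> - d * (1 + (R - \<delta>)) \<le> (1 - d) * (R - (\<delta> + d))"
      using d(1) by (simp add: algebra_simps)
    ultimately show ?thesis using de by linarith
  qed
  then show ?thesis by blast
qed

lemma tendsto_lambda_to_infinity:
  fixes g :: "real \<times> (real \<Rightarrow> real) \<Rightarrow> real"
  assumes \<zeta>: "\<zeta> \<subseteq> \<Phi> ` K"
    and g: "\<And>e. 0 < e \<Longrightarrow> \<exists>L. \<forall>l v. (l, v) \<in> K \<longrightarrow> L \<le> l \<longrightarrow> \<bar>g (l, state v) - c\<bar> \<le> e"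
  shows "(g \<longlongrightarrow> c) (lambda_to_infinity \<zeta>)"
proof (rule tendstoI)
  fix e :: real assume e: "0 < e"
  obtain L where L: "\<And>l v. (l, v) \<in> K \<Longrightarrow> L \<le> l \<Longrightarrow> \<bar>g (l, state v) - c\<bar> \<le> e / 2"
    using g[of "e / 2"] e by auto
  have "dist (g x) c < e" if x: "x \<in> \<zeta>" "L \<le> fst x" for x
  proof -
    obtain z where z: "z \<in> K" "x = \<Phi> z" using x(1) \<zeta> by blast
    obtain l v where "z = (l, v)" by (cases z)
    with z have "(l, v) \<in> K" "x = (l, state v)" by (simp_all add: \<Phi>_def)
    then show ?thesis using L[of l v] x(2) e by (simp add: dist_real_def)
  qed
  moreover have "\<forall>\<^sub>F l in at_top. L \<le> l" by (rule eventually_ge_at_top)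
  ultimately show "\<forall>\<^sub>F x in lambda_to_infinity \<zeta>. dist (g x) c < e"
    unfolding lambda_to_infinity_def eventually_inf_principal eventually_filtercomap by blast
qed

section \<open>The component\<close>

text \<open>The component of \<open>(0, \<theta>)\<close> in \<open>\<Sigma>\<^sub>\<delta>\<close> contains the branch of \<open>K_branch\<close> and is contained in the image of
\<open>K\<close>; the first gives its extent in the \<open>\<lambda>\<close> direction, the second all the estimates.\<close>

theorem bifurcation:
  "\<exists>\<zeta> \<in> connected_components_of (subtopology (RE_top \<delta> R) (Sigma_set N \<delta> R \<alpha> f)).
      \<zeta> - {(0, E_zero \<delta> R)} \<subseteq> {0<..} \<times> int_P \<delta> R \<and>
      joins_with_infinity \<delta> R \<zeta> 0 \<and>
      fst ` \<zeta> = {0..} \<and>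
      (\<forall>n\<ge>1. ((\<lambda>(l, u). measure lebesgue {r\<in>{\<delta>..R}. \<bar>der \<delta> R u r - (-1)\<bar> > 1 / real n})
                \<longlongrightarrow> 0) (lambda_to_infinity \<zeta>)) \<and>
      ((\<lambda>(l, u). sup_norm \<delta> R u) \<longlongrightarrow> R - \<delta>) (lambda_to_infinity \<zeta>)"
proof -
  obtain T where T: "connected T" "T \<subseteq> K" "(0, 0) \<in> T" "fst ` T = {0..}" by (rule K_branch)
  have "1 \<in> fst ` T" using T(4) by simp
  then obtain y where "y \<in> T" "fst y = 1" by force
  then have sub: "\<Phi> ` T \<subseteq> Sigma_set N \<delta> R \<alpha> f" by (intro branch_in_Sigma[OF T(1-3), of y]) auto
  define X where "X = subtopology (RE_top \<delta> R) (Sigma_set N \<delta> R \<alpha> f)"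
  have "connectedin (top_of_set K) T" using T by (simp add: connectedin_subtopology)
  from connectedin_continuous_map_image[OF continuous_map_\<Phi> this] sub
  have con: "connectedin X (\<Phi> ` T)" by (simp add: X_def connectedin_subtopology)
  define \<zeta> where "\<zeta> = connected_component_of_set X (\<Phi> (0, 0))"
  have T\<zeta>: "\<Phi> ` T \<subseteq> \<zeta>"
    unfolding \<zeta>_def using con T(3) by (intro connected_component_of_maximal) auto
  have X0: "\<Phi> (0, 0) \<in> topspace X"
    using connectedin_subset_topspace[OF con] T(3) by blast
  have \<zeta>K: "\<zeta> \<subseteq> \<Phi> ` K"
    using connected_component_of_subset_topspace[of X "\<Phi> (0, 0)"] Sigma_subset by (auto simp: \<zeta>_def X_def)
  have fst\<zeta>: "fst ` \<zeta> = {0..}"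
  proof
    show "fst ` \<zeta> \<subseteq> {0..}" using \<zeta>K K_props(1) by (force simp: \<Phi>_def)
    have "fst ` \<Phi> ` T = fst ` T" by (auto simp: \<Phi>_def image_image)
    then show "{0..} \<subseteq> fst ` \<zeta>" using T\<zeta> T(4) by (metis image_mono)
  qed
  show ?thesis
  proof (intro bexI[of _ \<zeta>] conjI allI impI)
    show "\<zeta> \<in> connected_components_of (subtopology (RE_top \<delta> R) (Sigma_set N \<delta> R \<alpha> f))"
      using X0 by (auto simp: connected_components_of_def \<zeta>_def X_def)
    show "\<zeta> - {(0, E_zero \<delta> R)} \<subseteq> {0<..} \<times> int_P \<delta> R"
    proof
      fix x assume x: "x \<in> \<zeta> - {(0, E_zero \<delta> R)}"
      then obtain z where z: "z \<in> K" "x = \<Phi> z" using \<zeta>K by blast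
      obtain l v where lv: "z = (l, v)" by (cases z)
      have "z \<noteq> (0, 0)" using x z \<Phi>_zero by auto
      then show "x \<in> {0<..} \<times> int_P \<delta> R"
        using K_positive(1)[of l v] state_in_int_P[of l v] z lv by (simp add: \<Phi>_def)
    qed
    show "fst ` \<zeta> = {0..}" by (rule fst\<zeta>)
    show "joins_with_infinity \<delta> R \<zeta> 0"
      unfolding joins_with_infinity_def
    proof (intro conjI allI)
      show "(0, E_zero \<delta> R) \<in> \<zeta>" using T\<zeta> T(3) \<Phi>_zero by force
      fix L :: real
      have "max 0 L + 1 \<in> fst ` \<zeta>" unfolding fst\<zeta> by simp
      then obtain x where "x \<in> \<zeta>" "fst x = max 0 L + 1" by force
      then show "\<exists>(l, u)\<in>\<zeta>. L < l" by (intro bexI[of _ x]) (auto simp: case_prod_unfold)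
    qed
    show "((\<lambda>(l, u). measure lebesgue {r\<in>{\<delta>..R}. \<bar>der \<delta> R u r - (-1)\<bar> > 1 / real n}) \<longlongrightarrow> 0)
        (lambda_to_infinity \<zeta>)" if "n \<ge> 1" for n
      using K_measure[OF that] by (intro tendsto_lambda_to_infinity[OF \<zeta>K]) simp
    show "((\<lambda>(l, u). sup_norm \<delta> R u) \<longlongrightarrow> R - \<delta>) (lambda_to_infinity \<zeta>)"
      using K_sup_norm by (intro tendsto_lambda_to_infinity[OF \<zeta>K]) simp
  qed
qed

end

theorem theorem1p2:
  fixes N :: nat and R \<delta> \<alpha> :: real and f :: "real \<Rightarrow> real \<Rightarrow> real"
  assumes "N \<ge> 2" and "0 < R" and "0 \<le> \<delta>" and "\<delta> < R" and "\<alpha> > R"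
    and f_cont: "continuous_on ({\<delta>..R} \<times> {0..<\<alpha>}) (\<lambda>(r, s). f r s)"
    and f_nonneg: "\<forall>r\<in>{\<delta>..R}. \<forall>s\<in>{0..<\<alpha>}. f r s \<ge> 0"
    and f_pos: "\<forall>r\<in>{\<delta>..R}. \<forall>s\<in>{0<..<\<alpha>}. f r s > 0"
    and f_superlinear: "\<forall>M. \<forall>\<^sub>F s in at_right 0. \<forall>r\<in>{\<delta>..R}. f r s / s > M"
    and f_zero: "\<forall>r\<in>{\<delta>..R}. f r 0 = 0"
  shows "\<exists>\<zeta> \<in> connected_components_of (subtopology (RE_top \<delta> R) (Sigma_set N \<delta> R \<alpha> f)).
      \<zeta> - {(0, E_zero \<delta> R)} \<subseteq> {0<..} \<times> int_P \<delta> R \<and>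
      joins_with_infinity \<delta> R \<zeta> 0 \<and>
      fst ` \<zeta> = {0..} \<and>
      (\<forall>n\<ge>1. ((\<lambda>(l, u). measure lebesgue {r\<in>{\<delta>..R}. \<bar>der \<delta> R u r - (-1)\<bar> > 1 / real n})
                \<longlongrightarrow> 0) (lambda_to_infinity \<zeta>)) \<and>
      ((\<lambda>(l, u). sup_norm \<delta> R u) \<longlongrightarrow> R - \<delta>) (lambda_to_infinity \<zeta>)"
proof -
  interpret mean_curvature_problem N R \<delta> \<alpha> f
    using assms by unfold_locales
  show ?thesis by (rule bifurcation)
qed

end
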